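(* Let $k$ be a unitarily invariant CNP kernel on $\mathbb{B}_d$. Let $\mathbf T=(T_1,\dots,T_d)$ be a $1/k$-contraction on a Hilbert space $\mathcal H$, with Taylor joint spectrum $\sigma(\mathbf T)$. Then the characteristic function $\theta_{\mathbf T}$ extends continuously to $\overline{\mathbb{B}}_d\setminus\sigma(\mathbf T)$.
   Context: $\mathbb{B}_d$ is the open Euclidean unit ball of $\mathbb{C}^d$ and $\overline{\mathbb{B}}_d$ its closure. A unitarily invariant CNP kernel on $\mathbb{B}_d$ (regularity is part of the definition) is a reproducing kernel $k(\bm z,\bm w)=\sum_{n=0}^\infty a_n\langle\bm z,\bm w\rangle^n$ on $\mathbb{B}_d$ with $a_0=1$, $a_n>0$ for all $n$, $\lim_{n\to\infty}a_n/a_{n+1}=1$, such that there are real numbers $b_n\ge 0$ ($n\ge1$) with $1-\frac{1}{k(\bm z,\bm w)}=\sum_{n=1}^\infty b_n\langle\bm z,\bm w\rangle^n$ for $\bm z,\bm w\in\mathbb{B}_d$ (equivalently $k$ is an irreducible complete Nevanlinna–Pick kernel). For $\alpha\in\mathbb{Z}_+^d\setminus\{0\}$ put $b_\alpha=b_{|\alpha|}\frac{|\alpha|!}{\alpha!}$. A commuting tuple $\mathbf T=(T_1,\dots,T_d)$ of bounded operators on a Hilbert space $\mathcal H$ is a $1/k$-contraction if $\sum_{\alpha\in\mathbb{Z}_+^d\setminus\{0\}}b_\alpha\mathbf T^\alpha(\mathbf T^\alpha)^*$ converges strongly to a contraction; then $\Delta_{\mathbf T}=\big(I-\sum_{\alpha\neq0}b_\alpha\mathbf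 T^\alpha(\mathbf T^\alpha)^*\big)^{1/2}$. Characteristic function: let $\tilde{\mathcal H}=\bigoplus_{\alpha\in\mathbb{Z}_+^d\setminus\{0\}}\mathcal H$. Let $\tilde{\mathbf T}:\tilde{\mathcal H}\to\mathcal H$, $(h_\alpha)\mapsto\sum_{\alpha\ne0}b_\alpha^{1/2}\mathbf T^\alpha h_\alpha$, and for $\bm z\in\mathbb{B}_d$ let $\mathbf Z:\tilde{\mathcal H}\to\mathcal H$, $(h_\alpha)\mapsto\sum_{\alpha\neq0}b_\alpha^{1/2}\bm z^\alpha h_\alpha$. Put $D_{\tilde{\mathbf T}}=(I-\tilde{\mathbf T}^*\tilde{\mathbf T})^{1/2}$ and $\mathcal D_{\tilde{\mathbf T}}=\overline{\mathrm{Ran}}\,D_{\tilde{\mathbf T}}$. Then $\theta_{\mathbf T}:\mathbb{B}_d\to\mathcal B(\mathcal D_{\tilde{\mathbf T}},\overline{\mathrm{Ran}}\,\Delta_{\mathbf T})$ is $\theta_{\mathbf T}(\bm z)=\big(-\tilde{\mathbf T}+\Delta_{\mathbf T}(I_{\mathcal H}-\mathbf Z\tilde{\mathbf T}^* )^{-1}\mathbf Z D_{\tilde{\mathbf T}}\big)|_{\mathcal D_{\tilde{\mathbf T}}}$. "Extends continuously to $\overline{\mathbb B}_d\setminus\sigma(\mathbf T)$" means there is an operator-norm continuous function on $\overline{\mathbb B}_d\setminus\sigma(\mathbf T)$ that agrees with $\theta_{\mathbf T}$ on $\mathbb B_d\setminus\sigma(\mathbf T)$. *)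

theory Defs
  imports "HOL-Analysis.Analysis"
begin

section \<open>Complex Hilbert spaces\<close>

text \<open>The inner product is linear in the first argument.\<close>

class complex_inner = real_normed_vector +
  fixes scaleC :: "complex \<Rightarrow> 'a \<Rightarrow> 'a" (infixr "*\<^sub>C" 75)
    and cinner :: "'a \<Rightarrow> 'a \<Rightarrow> complex"
  assumes scaleC_add_right: "c *\<^sub>C (x + y) = c *\<^sub>C x + c *\<^sub>C y"
    and scaleC_add_left: "(c + c') *\<^sub>C x = c *\<^sub>C x + c' *\<^sub>C x"
    and scaleC_scaleC: "c *\<^sub>C (c' *\<^sub>C x) = (c * c') *\<^sub>C x"
    and scaleC_of_real: "complex_of_real r *\<^sub>C x = r *\<^sub>R x"
    and cinner_commute: "cinner x y = cnj (cinner y x)"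
    and cinner_add_left: "cinner (x + y) z = cinner x z + cinner y z"
    and cinner_scaleC_left: "cinner (c *\<^sub>C x) y = c * cinner x y"
    and cinner_self: "cinner x x = complex_of_real ((norm x)\<^sup>2)"

class chilbert_space = complex_inner + complete_space

lemma cinner_add_right: "cinner x (y + z) = cinner x y + cinner x z"
  for x :: "'a::complex_inner"
  by (metis cinner_commute cinner_add_left complex_cnj_add)

lemma cinner_scaleC_right: "cinner x (c *\<^sub>C y) = cnj c * cinner x y"
  for x :: "'a::complex_inner"
  by (metis cinner_commute cinner_scaleC_left complex_cnj_mult)

lemma norm_scaleC: "norm (c *\<^sub>C x) = norm c * norm x"
  for x :: "'a::complex_inner"
proof -
  have "cinner (c *\<^sub>C x) (c *\<^sub>C x) = (c * cnj c) * cinner x x"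
    by (simp add: cinner_scaleC_left cinner_scaleC_right)
  also have "c * cnj c = complex_of_real ((norm c)\<^sup>2)"
    using complex_norm_square[of c] by simp
  finally have "complex_of_real ((norm (c *\<^sub>C x))\<^sup>2) = complex_of_real ((norm c * norm x)\<^sup>2)"
    by (simp add: cinner_self power_mult_distrib)
  then have "(norm (c *\<^sub>C x))\<^sup>2 = (norm c * norm x)\<^sup>2"
    by (simp only: of_real_eq_iff)
  then show ?thesis by (simp add: power2_eq_iff_nonneg)
qed

lemma norm_cinner_le_sum_squares: "norm (cinner x y) \<le> (norm x)\<^sup>2 + (norm y)\<^sup>2"
  for x :: "'a::complex_inner"
proof -
  define u where "u = - sgn (cinner x y)"
  have u: "cnj u * cinner x y = - of_real (norm (cinner x y))"
  proof (cases "cinner x y = 0")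
    case False
    have "cnj (cinner x y) * cinner x y = of_real (norm (cinner x y)) * of_real (norm (cinner x y))"
      by (metis complex_norm_square mult.commute of_real_mult power2_eq_square)
    then show ?thesis
      using False by (simp add: u_def sgn_div_norm scaleR_conv_of_real field_simps)
  qed (simp add: u_def)
  have nu: "norm u \<le> 1" by (simp add: u_def norm_sgn)
  have "complex_of_real ((norm (x + u *\<^sub>C y))\<^sup>2)
      = cinner x x + cnj u * cinner x y + cnj (cnj u * cinner x y) + cinner (u *\<^sub>C y) (u *\<^sub>C y)"
    unfolding cinner_self[of "x + u *\<^sub>C y", symmetric]
    by (simp add: cinner_add_left cinner_add_right cinner_scaleC_left cinner_scaleC_right
        cinner_commute[symmetric] algebra_simps)
  also have "\<dots> = complex_of_real ((norm x)\<^sup>2 - 2 * norm (cinner x y) + (norm u * norm y)\<^sup>2)"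
    by (simp add: u cinner_self norm_scaleC)
  finally have "(norm (x + u *\<^sub>C y))\<^sup>2 = (norm x)\<^sup>2 - 2 * norm (cinner x y) + (norm u * norm y)\<^sup>2"
    by (simp only: of_real_eq_iff)
  moreover have "(norm u * norm y)\<^sup>2 \<le> (norm y)\<^sup>2"
    using nu by (simp add: mult_left_le_one_le power_mono)
  ultimately have "0 \<le> (norm x)\<^sup>2 - 2 * norm (cinner x y) + (norm y)\<^sup>2"
    by (smt (verit) zero_le_power2)
  then show ?thesis
    using norm_ge_zero[of "cinner x y"] by linarith
qed

instantiation complex :: chilbert_space
begin
definition scaleC_complex :: "complex \<Rightarrow> complex \<Rightarrow> complex" where "scaleC_complex c x = c * x"
definition cinner_complex :: "complex \<Rightarrow> complex \<Rightarrow> complex" where "cinner_complex x y = x * cnj y"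
instance
  by standard
    (auto simp: scaleC_complex_def cinner_complex_def algebra_simps scaleR_conv_of_real
      simp flip: complex_norm_square)
end

instantiation vec :: (complex_inner, finite) complex_inner
begin
definition scaleC_vec :: "complex \<Rightarrow> 'a ^ 'b \<Rightarrow> 'a ^ 'b"
  where "scaleC_vec c x = (\<chi> i. c *\<^sub>C (x $ i))"
definition cinner_vec :: "'a ^ 'b \<Rightarrow> 'a ^ 'b \<Rightarrow> complex"
  where "cinner_vec x y = (\<Sum>i\<in>UNIV. cinner (x $ i) (y $ i))"
instance
proof
  fix x y z :: "'a ^ 'b" and c c' :: complex and r :: real
  show "c *\<^sub>C (x + y) = c *\<^sub>C x + c *\<^sub>C y"
    by (simp add: scaleC_vec_def vec_eq_iff scaleC_add_right)
  show "(c + c') *\<^sub>C x = c *\<^sub>C x + c' *\<^sub>C x"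
    by (simp add: scaleC_vec_def vec_eq_iff scaleC_add_left)
  show "c *\<^sub>C (c' *\<^sub>C x) = (c * c') *\<^sub>C x"
    by (simp add: scaleC_vec_def vec_eq_iff scaleC_scaleC)
  show "complex_of_real r *\<^sub>C x = r *\<^sub>R x"
    by (simp add: scaleC_vec_def vec_eq_iff scaleC_of_real)
  show "cinner x y = cnj (cinner y x)"
    by (simp add: cinner_vec_def flip: cinner_commute)
  show "cinner (x + y) z = cinner x z + cinner y z"
    by (simp add: cinner_vec_def cinner_add_left sum.distrib)
  show "cinner (c *\<^sub>C x) y = c * cinner x y"
    by (simp add: cinner_vec_def scaleC_vec_def cinner_scaleC_left sum_distrib_left)
  show "cinner x x = complex_of_real ((norm x)\<^sup>2)"
    by (simp add: cinner_vec_def cinner_self norm_vec_def L2_set_def sum_nonneg)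
qed
end

instance vec :: (chilbert_space, finite) chilbert_space ..


section \<open>Hilbert direct sums of copies of a Hilbert space\<close>

typedef (overloaded) ('i, 'h) hsum =
  "{f :: 'i \<Rightarrow> 'h::real_normed_vector. (\<lambda>i. (norm (f i))\<^sup>2) summable_on UNIV}"
  morphisms hsum_nth Abs_hsum
  by (rule exI[of _ "\<lambda>_. 0"]) simp

lemma hsum_eqI: "(\<And>i. hsum_nth x i = hsum_nth y i) \<Longrightarrow> x = y"
  by (metis ext hsum_nth_inject)

lemma hsum_summable: "(\<lambda>i. (norm (hsum_nth x i))\<^sup>2) summable_on UNIV"
  using hsum_nth[of x] by simp

lemma hsum_memI:
  assumes "\<And>F. finite F \<Longrightarrow> L2_set (\<lambda>i. norm (f i)) F \<le> C"
  shows "f \<in> {f. (\<lambda>i. (norm (f i))\<^sup>2) summable_on UNIV}"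
proof -
  have "(\<Sum>i\<in>F. (norm (f i))\<^sup>2) \<le> C\<^sup>2" if "finite F" for F
  proof -
    have "(L2_set (\<lambda>i. norm (f i)) F)\<^sup>2 \<le> C\<^sup>2"
      by (rule power_mono[OF assms[OF that]]) simp
    then show ?thesis by (simp add: L2_set_def sum_nonneg)
  qed
  then have "bdd_above (sum (\<lambda>i. (norm (f i))\<^sup>2) ` {F. F \<subseteq> UNIV \<and> finite F})"
    by (intro bdd_aboveI[where M = "C\<^sup>2"]) auto
  then show ?thesis
    by (auto intro: nonneg_bdd_above_summable_on)
qed

definition hsum_norm :: "('i, 'h::real_normed_vector) hsum \<Rightarrow> real"
  where "hsum_norm x = sqrt (\<Sum>\<^sub>\<infinity>i. (norm (hsum_nth x i))\<^sup>2)"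

lemma hsum_norm_nonneg: "0 \<le> hsum_norm x"
  by (simp add: hsum_norm_def infsum_nonneg)

lemma L2_set_le_hsum_norm:
  assumes "finite F" shows "L2_set (\<lambda>i. norm (hsum_nth x i)) F \<le> hsum_norm x"
  unfolding hsum_norm_def L2_set_def
  by (intro real_sqrt_le_mono finite_sum_le_infsum hsum_summable assms) auto

lemma hsum_norm_leI:
  assumes "\<And>F. finite F \<Longrightarrow> L2_set (\<lambda>i. norm (hsum_nth x i)) F \<le> C"
  shows "hsum_norm x \<le> C"
proof -
  have C: "0 \<le> C" using assms[of "{}"] by simp
  have "(\<Sum>i\<in>F. (norm (hsum_nth x i))\<^sup>2) \<le> C\<^sup>2" if "finite F" for F
  proof -
    have "(L2_set (\<lambda>i. norm (hsum_nth x i)) F)\<^sup>2 \<le> C\<^sup>2"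
      by (rule power_mono[OF assms[OF that]]) simp
    then show ?thesis by (simp add: L2_set_def sum_nonneg)
  qed
  then have "(\<Sum>\<^sub>\<infinity>i. (norm (hsum_nth x i))\<^sup>2) \<le> C\<^sup>2"
    by (intro infsum_le_finite_sums hsum_summable) auto
  then show ?thesis
    unfolding hsum_norm_def using C real_le_lsqrt by blast
qed

lemma norm_hsum_nth_le: "norm (hsum_nth x i) \<le> hsum_norm x"
  using L2_set_le_hsum_norm[of "{i}" x] by simp

instantiation hsum :: (type, real_normed_vector) real_vector
begin
definition zero_hsum :: "('a, 'b) hsum" where "0 = Abs_hsum (\<lambda>_. 0)"
definition plus_hsum :: "('a, 'b) hsum \<Rightarrow> ('a, 'b) hsum \<Rightarrow> ('a, 'b) hsum"
  where "x + y = Abs_hsum (\<lambda>i. hsum_nth x i + hsum_nth y i)"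
definition uminus_hsum :: "('a, 'b) hsum \<Rightarrow> ('a, 'b) hsum"
  where "- x = Abs_hsum (\<lambda>i. - hsum_nth x i)"
definition minus_hsum :: "('a, 'b) hsum \<Rightarrow> ('a, 'b) hsum \<Rightarrow> ('a, 'b) hsum"
  where "x - y = x + - (y :: ('a, 'b) hsum)"
definition scaleR_hsum :: "real \<Rightarrow> ('a, 'b) hsum \<Rightarrow> ('a, 'b) hsum"
  where "r *\<^sub>R x = Abs_hsum (\<lambda>i. r *\<^sub>R hsum_nth x i)"

lemma hsum_nth_zero [simp]: "hsum_nth (0 :: ('a, 'b) hsum) i = 0"
  by (simp add: zero_hsum_def Abs_hsum_inverse)

lemma L2_set_hsum_add_le:
  assumes "finite F"
  shows "L2_set (\<lambda>i. norm (hsum_nth x i + hsum_nth y i)) F \<le> hsum_norm x + hsum_norm y"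
proof -
  have "L2_set (\<lambda>i. norm (hsum_nth x i + hsum_nth y i)) F
      \<le> L2_set (\<lambda>i. norm (hsum_nth x i) + norm (hsum_nth y i)) F"
    by (intro L2_set_mono norm_triangle_ineq) auto
  also have "\<dots> \<le> L2_set (\<lambda>i. norm (hsum_nth x i)) F + L2_set (\<lambda>i. norm (hsum_nth y i)) F"
    by (rule L2_set_triangle_ineq)
  finally show ?thesis
    using L2_set_le_hsum_norm[OF assms, of x] L2_set_le_hsum_norm[OF assms, of y] by linarith
qed

lemma hsum_nth_add [simp]: "hsum_nth (x + y :: ('a, 'b) hsum) i = hsum_nth x i + hsum_nth y i"
  unfolding plus_hsum_def
  by (subst Abs_hsum_inverse[OF hsum_memI[OF L2_set_hsum_add_le]]) auto

lemma hsum_nth_uminus [simp]: "hsum_nth (- x :: ('a, 'b) hsum) i = - hsum_nth x i"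
  unfolding uminus_hsum_def
  by (subst Abs_hsum_inverse) (auto simp: hsum_summable)

lemma hsum_nth_minus [simp]: "hsum_nth (x - y :: ('a, 'b) hsum) i = hsum_nth x i - hsum_nth y i"
  by (simp add: minus_hsum_def)

lemma hsum_nth_scaleR [simp]: "hsum_nth (r *\<^sub>R x :: ('a, 'b) hsum) i = r *\<^sub>R hsum_nth x i"
  unfolding scaleR_hsum_def
  by (subst Abs_hsum_inverse)
    (auto simp: power_mult_distrib intro!: summable_on_cmult_right hsum_summable)

instance
  by standard (auto intro!: hsum_eqI simp: algebra_simps)
end

instantiation hsum :: (type, real_normed_vector) real_normed_vector
begin
definition norm_hsum :: "('a, 'b) hsum \<Rightarrow> real" where "norm_hsum = hsum_norm"
definition sgn_hsum :: "('a, 'b) hsum \<Rightarrow> ('a, 'b) hsum" where "sgn_hsum x = inverse (norm x) *\<^sub>R (x :: ('a, 'b) hsum)"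
definition dist_hsum :: "('a, 'b) hsum \<Rightarrow> ('a, 'b) hsum \<Rightarrow> real" where "dist_hsum x y = norm (x - (y :: ('a, 'b) hsum))"
definition uniformity_hsum :: "(('a, 'b) hsum \<times> ('a, 'b) hsum) filter"
  where "uniformity_hsum = (INF e\<in>{0 <..}. principal {(x, y). dist x y < e})"
definition open_hsum :: "('a, 'b) hsum set \<Rightarrow> bool"
  where "open_hsum U \<longleftrightarrow> (\<forall>x\<in>U. eventually (\<lambda>(x', y). x' = x \<longrightarrow> y \<in> U) uniformity)"
instance
proof
  fix x y :: "('a, 'b) hsum" and r :: real and U :: "('a, 'b) hsum set"
  show "dist x y = norm (x - y)" by (rule dist_hsum_def)
  show "sgn x = inverse (norm x) *\<^sub>R x" by (rule sgn_hsum_def)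
  show "(uniformity :: (('a, 'b) hsum \<times> ('a, 'b) hsum) filter)
      = (INF e\<in>{0 <..}. principal {(x, y). dist x y < e})"
    by (rule uniformity_hsum_def)
  show "open U \<longleftrightarrow> (\<forall>x\<in>U. eventually (\<lambda>(x', y). x' = x \<longrightarrow> y \<in> U) uniformity)"
    by (rule open_hsum_def)
  show "norm x = 0 \<longleftrightarrow> x = 0"
  proof
    assume "norm x = 0"
    then have "norm (hsum_nth x i) \<le> 0" for i
      using norm_hsum_nth_le[of x i] by (simp add: norm_hsum_def)
    then show "x = 0" by (intro hsum_eqI) simp
  qed (simp add: norm_hsum_def hsum_norm_def)
  show "norm (x + y) \<le> norm x + norm y"
    unfolding norm_hsum_def
    by (rule hsum_norm_leI) (simp add: L2_set_hsum_add_le)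
  show "norm (r *\<^sub>R x) = \<bar>r\<bar> * norm x"
    by (simp add: norm_hsum_def hsum_norm_def power_mult_distrib infsum_cmult_right'
        real_sqrt_mult)
qed
end

instantiation hsum :: (type, complex_inner) complex_inner
begin
definition scaleC_hsum :: "complex \<Rightarrow> ('a, 'b) hsum \<Rightarrow> ('a, 'b) hsum"
  where "c *\<^sub>C x = Abs_hsum (\<lambda>i. c *\<^sub>C hsum_nth x i)"
definition cinner_hsum :: "('a, 'b) hsum \<Rightarrow> ('a, 'b) hsum \<Rightarrow> complex"
  where "cinner x y = (\<Sum>\<^sub>\<infinity>i. cinner (hsum_nth x i) (hsum_nth y i))"

lemma hsum_nth_scaleC [simp]: "hsum_nth (c *\<^sub>C x :: ('a, 'b) hsum) i = c *\<^sub>C hsum_nth x i"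
  unfolding scaleC_hsum_def
  by (subst Abs_hsum_inverse)
    (auto simp: norm_scaleC power_mult_distrib intro!: summable_on_cmult_right hsum_summable)

lemma summable_cinner_hsum:
  "(\<lambda>i. cinner (hsum_nth x i) (hsum_nth (y :: ('a, 'b) hsum) i)) summable_on UNIV"
proof -
  have "(\<lambda>i. (norm (hsum_nth x i))\<^sup>2 + (norm (hsum_nth y i))\<^sup>2) summable_on UNIV"
    by (intro summable_on_add hsum_summable)
  then have "(\<lambda>i. norm (cinner (hsum_nth x i) (hsum_nth y i))) summable_on UNIV"
    by (rule summable_on_comparison_test) (auto intro: norm_cinner_le_sum_squares)
  then show ?thesis by (rule abs_summable_summable)
qed

instance
proof
  fix x y z :: "('a, 'b) hsum" and c c' :: complex and r :: real
  show "c *\<^sub>C (x + y) = c *\<^sub>C x + c *\<^sub>C y"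
    by (rule hsum_eqI) (simp add: scaleC_add_right)
  show "(c + c') *\<^sub>C x = c *\<^sub>C x + c' *\<^sub>C x"
    by (rule hsum_eqI) (simp add: scaleC_add_left)
  show "c *\<^sub>C (c' *\<^sub>C x) = (c * c') *\<^sub>C x"
    by (rule hsum_eqI) (simp add: scaleC_scaleC)
  show "complex_of_real r *\<^sub>C x = r *\<^sub>R x"
    by (rule hsum_eqI) (simp add: scaleC_of_real)
  show "cinner x y = cnj (cinner y x)"
    by (simp add: cinner_hsum_def flip: infsum_cnj cinner_commute)
  show "cinner (x + y) z = cinner x z + cinner y z"
    by (simp add: cinner_hsum_def cinner_add_left infsum_add summable_cinner_hsum)
  show "cinner (c *\<^sub>C x) y = c * cinner x y"
    by (simp add: cinner_hsum_def cinner_scaleC_left infsum_cmult_right')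
  have "((\<lambda>i. complex_of_real ((norm (hsum_nth x i))\<^sup>2)) has_sum
      complex_of_real (\<Sum>\<^sub>\<infinity>i. (norm (hsum_nth x i))\<^sup>2)) UNIV"
    by (rule has_sum_of_real) (rule has_sum_infsum[OF hsum_summable])
  moreover have "(norm x)\<^sup>2 = (\<Sum>\<^sub>\<infinity>i. (norm (hsum_nth x i))\<^sup>2)"
    by (simp add: norm_hsum_def hsum_norm_def infsum_nonneg)
  ultimately show "cinner x x = complex_of_real ((norm x)\<^sup>2)"
    by (simp add: cinner_hsum_def cinner_self infsumI)
qed
end

instance hsum :: (type, chilbert_space) chilbert_space
proof
  fix X :: "nat \<Rightarrow> ('a, 'b) hsum"
  assume X: "Cauchy X"
  have nth_le: "norm (hsum_nth (X m) i - hsum_nth (X n) i) \<le> norm (X m - X n)" for m n i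
    using norm_hsum_nth_le[of "X m - X n" i] by (simp add: norm_hsum_def)
  have "Cauchy (\<lambda>n. hsum_nth (X n) i)" for i
    unfolding Cauchy_iff
  proof (intro allI impI)
    fix e :: real assume "0 < e"
    with X obtain M where "\<forall>m\<ge>M. \<forall>n\<ge>M. norm (X m - X n) < e"
      unfolding Cauchy_iff by blast
    then show "\<exists>M. \<forall>m\<ge>M. \<forall>n\<ge>M. norm (hsum_nth (X m) i - hsum_nth (X n) i) < e"
      using nth_le by (meson le_less_trans)
  qed
  then have "\<exists>l. (\<lambda>n. hsum_nth (X n) i) \<longlonglongrightarrow> l" for i
    using Cauchy_convergent convergent_def by blast
  then obtain f where f: "\<And>i. (\<lambda>n. hsum_nth (X n) i) \<longlonglongrightarrow> f i"
    by metis
  have L2_le: "L2_set (\<lambda>i. norm (hsum_nth (X m) i - f i)) F \<le> e"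
    if e: "\<forall>n\<ge>M. norm (X m - X n) < e" and F: "finite F" for e M m F
  proof (rule tendsto_upperbound)
    show "(\<lambda>n. L2_set (\<lambda>i. norm (hsum_nth (X m) i - hsum_nth (X n) i)) F)
        \<longlonglongrightarrow> L2_set (\<lambda>i. norm (hsum_nth (X m) i - f i)) F"
      unfolding L2_set_def by (intro tendsto_intros f)
    show "\<forall>\<^sub>F n in sequentially.
        L2_set (\<lambda>i. norm (hsum_nth (X m) i - hsum_nth (X n) i)) F \<le> e"
      using eventually_ge_at_top[of M]
    proof eventually_elim
      case (elim n)
      then show ?case
        using L2_set_le_hsum_norm[OF F, of "X m - X n"] e by (fastforce simp: norm_hsum_def)
    qed
  qed simp
  obtain M where M: "\<forall>m\<ge>M. \<forall>n\<ge>M. norm (X m - X n) < 1"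
    using X unfolding Cauchy_iff by (meson zero_less_one)
  have "(\<lambda>i. hsum_nth (X M) i - f i) \<in> {f. (\<lambda>i. (norm (f i))\<^sup>2) summable_on UNIV}"
    by (rule hsum_memI[where C = 1], rule L2_le[where M = M]) (use M in auto)
  then have g: "hsum_nth (Abs_hsum (\<lambda>i. hsum_nth (X M) i - f i)) = (\<lambda>i. hsum_nth (X M) i - f i)"
    by (rule Abs_hsum_inverse)
  define l where "l = X M - Abs_hsum (\<lambda>i. hsum_nth (X M) i - f i)"
  have l: "hsum_nth l i = f i" for i
    by (simp add: l_def g)
  have "X \<longlonglongrightarrow> l"
  proof (rule LIMSEQ_I)
    fix e :: real assume e: "0 < e"
    then obtain N where N: "\<forall>m\<ge>N. \<forall>n\<ge>N. norm (X m - X n) < e / 2"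
      using X unfolding Cauchy_iff by (meson half_gt_zero)
    have "norm (X m - l) < e" if "m \<ge> N" for m
    proof -
      have "norm (X m - l) \<le> e / 2"
        unfolding norm_hsum_def
        by (rule hsum_norm_leI) (use N that L2_le[where M = N and m = m and e = "e / 2"] in \<open>simp add: l\<close>)
      then show ?thesis using e by simp
    qed
    then show "\<exists>N. \<forall>m\<ge>N. norm (X m - l) < e" by blast
  qed
  then show "convergent X" by (auto simp: convergent_def)
qed


section \<open>Operators\<close>

definition bounded_clinear :: "('a::complex_inner \<Rightarrow> 'b::complex_inner) \<Rightarrow> bool"
  where "bounded_clinear A \<longleftrightarrow> bounded_linear A \<and> (\<forall>c x. A (c *\<^sub>C x) = c *\<^sub>C A x)"

definition cadjoint :: "('a::complex_inner \<Rightarrow> 'b::complex_inner) \<Rightarrow> 'b \<Rightarrow> 'a"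
  where "cadjoint A = (THE B. \<forall>x y. cinner (A x) y = cinner x (B y))"

definition positive_op :: "('a::complex_inner \<Rightarrow> 'a) \<Rightarrow> bool"
  where "positive_op A \<longleftrightarrow> bounded_clinear A \<and> (\<forall>x. cinner (A x) x \<in> \<real>\<^sub>\<ge>\<^sub>0)"

definition sqrt_op :: "('a::complex_inner \<Rightarrow> 'a) \<Rightarrow> 'a \<Rightarrow> 'a"
  where "sqrt_op A = (THE S. positive_op S \<and> S \<circ> S = A)"

text \<open>For closed subspaces \<open>V\<close> and \<open>W\<close>, elements of \<open>\<B>(V, W)\<close> are represented by functions on the
  ambient space of which only the values on \<open>V\<close> matter. The quotient \<open>0 / 0 = 0\<close> in \<open>onorm_on\<close>
  is harmless, as in \<^const>\<open>onorm\<close>.\<close>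

definition bounded_ops :: "'a::complex_inner set \<Rightarrow> 'b::complex_inner set \<Rightarrow> ('a \<Rightarrow> 'b) set"
  where "bounded_ops V W = {A. (\<forall>x\<in>V. A x \<in> W) \<and>
    (\<forall>x\<in>V. \<forall>y\<in>V. A (x + y) = A x + A y) \<and> (\<forall>c. \<forall>x\<in>V. A (c *\<^sub>C x) = c *\<^sub>C A x) \<and>
    (\<exists>K. \<forall>x\<in>V. norm (A x) \<le> K * norm x)}"

definition onorm_on :: "'a::real_normed_vector set \<Rightarrow> ('a \<Rightarrow> 'b::real_normed_vector) \<Rightarrow> real"
  where "onorm_on V A = (SUP x\<in>V. norm (A x) / norm x)"

definition opnorm_continuous_on ::
    "'z::topological_space set \<Rightarrow> 'a::complex_inner set \<Rightarrow> 'b::complex_inner set \<Rightarrow>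
     ('z \<Rightarrow> 'a \<Rightarrow> 'b) \<Rightarrow> bool"
  where "opnorm_continuous_on X V W F \<longleftrightarrow> (\<forall>z\<in>X. F z \<in> bounded_ops V W) \<and>
    (\<forall>z\<in>X. ((\<lambda>w. onorm_on V (\<lambda>x. F w x - F z x)) \<longlongrightarrow> 0) (at z within X))"


section \<open>Multi-indices and tuples of operators\<close>

typedef 'd nzindex = "{\<alpha> :: 'd::finite \<Rightarrow> nat. \<alpha> \<noteq> (\<lambda>_. 0)}"
  morphisms midx Abs_nzindex
  by (rule exI[of _ "\<lambda>_. 1"]) (simp add: fun_eq_iff)

definition msize :: "('d::finite \<Rightarrow> nat) \<Rightarrow> nat"
  where "msize \<alpha> = (\<Sum>i\<in>UNIV. \<alpha> i)"

definition mfact :: "('d::finite \<Rightarrow> nat) \<Rightarrow> nat"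
  where "mfact \<alpha> = (\<Prod>i\<in>UNIV. fact (\<alpha> i))"

definition mpower :: "complex ^ 'd::finite \<Rightarrow> ('d \<Rightarrow> nat) \<Rightarrow> complex"
  where "mpower z \<alpha> = (\<Prod>i\<in>UNIV. (z $ i) ^ \<alpha> i)"

definition commuting_tuple :: "('d \<Rightarrow> 'h::complex_inner \<Rightarrow> 'h) \<Rightarrow> bool"
  where "commuting_tuple T \<longleftrightarrow>
    (\<forall>i. bounded_clinear (T i)) \<and> (\<forall>i j. T i \<circ> T j = T j \<circ> T i)"

definition op_mpower :: "('d::{finite,linorder} \<Rightarrow> 'h \<Rightarrow> 'h) \<Rightarrow> ('d \<Rightarrow> nat) \<Rightarrow> 'h \<Rightarrow> 'h"
  where "op_mpower T \<alpha> = foldr (\<lambda>i A. (T i ^^ \<alpha> i) \<circ> A) (sorted_list_of_set UNIV) id"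


section \<open>The Taylor joint spectrum\<close>

text \<open>A function \<open>\<omega> :: 'd set \<Rightarrow> 'h\<close> stands for \<open>\<Sum>\<^sub>S e\<^sub>S \<otimes> \<omega> S\<close> in \<open>\<Lambda>(\<complex>\<^sup>d) \<otimes> \<H>\<close>, where
  \<open>e\<^sub>S = e\<^bsub>i1\<^esub> \<and> \<dots> \<and> e\<^bsub>ip\<^esub>\<close> for \<open>S = {i1 < \<dots> < ip}\<close>. The differential of the Koszul complex is
  \<open>e\<^sub>S \<otimes> h \<mapsto> \<Sum>\<^sub>i (e\<^sub>i \<and> e\<^sub>S) \<otimes> A\<^sub>i h\<close>; it raises the degree by one, so the equality of its kernel and
  range on the whole graded space is exactness in every degree.\<close>

definition koszul_diff ::
    "('d::{finite,linorder} \<Rightarrow> 'h::complex_inner \<Rightarrow> 'h) \<Rightarrow> ('d set \<Rightarrow> 'h) \<Rightarrow> 'd set \<Rightarrow> 'h"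
  where "koszul_diff A \<omega> S = (\<Sum>i\<in>S. (- 1) ^ card {j\<in>S. j < i} *\<^sub>R A i (\<omega> (S - {i})))"

definition koszul_exact :: "('d::{finite,linorder} \<Rightarrow> 'h::complex_inner \<Rightarrow> 'h) \<Rightarrow> bool"
  where "koszul_exact A \<longleftrightarrow> {\<omega>. koszul_diff A \<omega> = (\<lambda>_. 0)} = range (koszul_diff A)"

definition taylor_spectrum ::
    "('d::{finite,linorder} \<Rightarrow> 'h::complex_inner \<Rightarrow> 'h) \<Rightarrow> (complex ^ 'd::{finite,linorder}) set"
  where "taylor_spectrum T = {z. \<not> koszul_exact (\<lambda>i h. T i h - (z $ i) *\<^sub>C h)}"


section \<open>Unitarily invariant CNP kernels\<close>

definition positive_kernel_on :: "'z set \<Rightarrow> ('z \<Rightarrow> 'z \<Rightarrow> complex) \<Rightarrow> bool"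
  where "positive_kernel_on X k \<longleftrightarrow> (\<forall>F c. finite F \<longrightarrow> F \<subseteq> X \<longrightarrow>
    (\<Sum>z\<in>F. \<Sum>w\<in>F. c z * cnj (c w) * k z w) \<in> \<real>\<^sub>\<ge>\<^sub>0)"

text \<open>The coefficients \<open>a\<close> and \<open>b\<close> are determined by \<open>k\<close>, except for the unused value \<open>b 0\<close>.\<close>

definition unitarily_invariant_CNP_kernel ::
    "(complex ^ 'd \<Rightarrow> complex ^ 'd \<Rightarrow> complex) \<Rightarrow> (nat \<Rightarrow> real) \<Rightarrow> (nat \<Rightarrow> real) \<Rightarrow> bool"
  where "unitarily_invariant_CNP_kernel k a b \<longleftrightarrow>
    positive_kernel_on (ball 0 1) k \<and>
    (\<forall>z\<in>ball 0 1. \<forall>w\<in>ball 0 1. (\<lambda>n. complex_of_real (a n) * cinner z w ^ n) sums k z w) \<and>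
    a 0 = 1 \<and> (\<forall>n. a n > 0) \<and> (\<lambda>n. a n / a (Suc n)) \<longlonglongrightarrow> 1 \<and>
    (\<forall>n\<ge>1. b n \<ge> 0) \<and>
    (\<forall>z\<in>ball 0 1. \<forall>w\<in>ball 0 1. k z w \<noteq> 0 \<and>
      (\<lambda>n. complex_of_real (b (Suc n)) * cinner z w ^ Suc n) sums (1 - 1 / k z w))"


section \<open>1/k-contractions and the characteristic function\<close>

definition mcoeff :: "(nat \<Rightarrow> real) \<Rightarrow> 'd::finite nzindex \<Rightarrow> real"
  where "mcoeff b \<alpha> = b (msize (midx \<alpha>)) * fact (msize (midx \<alpha>)) / real (mfact (midx \<alpha>))"

definition kernel_sum_term ::
    "(nat \<Rightarrow> real) \<Rightarrow> ('d::{finite,linorder} \<Rightarrow> 'h::complex_inner \<Rightarrow> 'h) \<Rightarrow> 'd nzindex \<Rightarrow> 'h \<Rightarrow> 'h"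
  where "kernel_sum_term b T \<alpha> h =
    mcoeff b \<alpha> *\<^sub>R op_mpower T (midx \<alpha>) (cadjoint (op_mpower T (midx \<alpha>)) h)"

text \<open>The terms are positive operators, so strong convergence does not depend on the order of
  summation.\<close>

definition inverse_kernel_contraction ::
    "(nat \<Rightarrow> real) \<Rightarrow> ('d::{finite,linorder} \<Rightarrow> 'h::complex_inner \<Rightarrow> 'h) \<Rightarrow> bool"
  where "inverse_kernel_contraction b T \<longleftrightarrow> commuting_tuple T \<and>
    (\<forall>h. (\<lambda>\<alpha>. kernel_sum_term b T \<alpha> h) summable_on UNIV \<and>
         norm (\<Sum>\<^sub>\<infinity>\<alpha>. kernel_sum_term b T \<alpha> h) \<le> norm h)"

definition defect_op ::
    "(nat \<Rightarrow> real) \<Rightarrow> ('d::{finite,linorder} \<Rightarrow> 'h::complex_inner \<Rightarrow> 'h) \<Rightarrow> 'h \<Rightarrow> 'h"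
  where "defect_op b T = sqrt_op (\<lambda>h. h - (\<Sum>\<^sub>\<infinity>\<alpha>. kernel_sum_term b T \<alpha> h))"

definition row_op ::
    "(nat \<Rightarrow> real) \<Rightarrow> ('d::{finite,linorder} \<Rightarrow> 'h::complex_inner \<Rightarrow> 'h) \<Rightarrow> ('d nzindex, 'h) hsum \<Rightarrow> 'h"
  where "row_op b T x = (\<Sum>\<^sub>\<infinity>\<alpha>. sqrt (mcoeff b \<alpha>) *\<^sub>R op_mpower T (midx \<alpha>) (hsum_nth x \<alpha>))"

definition row_scalar ::
    "(nat \<Rightarrow> real) \<Rightarrow> complex ^ 'd \<Rightarrow> ('d nzindex, 'h::complex_inner) hsum \<Rightarrow> 'h"
  where "row_scalar b z x = (\<Sum>\<^sub>\<infinity>\<alpha>. sqrt (mcoeff b \<alpha>) *\<^sub>R mpower z (midx \<alpha>) *\<^sub>C hsum_nth x \<alpha>)"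

definition row_defect_op ::
    "(nat \<Rightarrow> real) \<Rightarrow> ('d::{finite,linorder} \<Rightarrow> 'h::complex_inner \<Rightarrow> 'h) \<Rightarrow>
     ('d nzindex, 'h) hsum \<Rightarrow> ('d nzindex, 'h) hsum"
  where "row_defect_op b T = sqrt_op (\<lambda>x. x - cadjoint (row_op b T) (row_op b T x))"

definition row_defect_space ::
    "(nat \<Rightarrow> real) \<Rightarrow> ('d::{finite,linorder} \<Rightarrow> 'h::complex_inner \<Rightarrow> 'h) \<Rightarrow> ('d nzindex, 'h) hsum set"
  where "row_defect_space b T = closure (range (row_defect_op b T))"

definition defect_space ::
    "(nat \<Rightarrow> real) \<Rightarrow> ('d::{finite,linorder} \<Rightarrow> 'h::complex_inner \<Rightarrow> 'h) \<Rightarrow> 'h set"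
  where "defect_space b T = closure (range (defect_op b T))"

text \<open>Only the values at \<open>z\<close> in the open unit ball and \<open>x\<close> in \<open>row_defect_space b T\<close> are meant.\<close>

definition char_fun ::
    "(nat \<Rightarrow> real) \<Rightarrow> ('d::{finite,linorder} \<Rightarrow> 'h::complex_inner \<Rightarrow> 'h) \<Rightarrow>
     complex ^ 'd::{finite,linorder} \<Rightarrow> ('d nzindex, 'h) hsum \<Rightarrow> 'h"
  where "char_fun b T z x = - row_op b T x +
    defect_op b T (inv (\<lambda>h. h - row_scalar b z (cadjoint (row_op b T) h))
      (row_scalar b z (row_defect_op b T x)))"

end

theory Submission
  imports Defs
begin

text \<open>The extension is given by the same formula on the whole of the closed ball minus \<open>\<sigma>(T)\<close>. Let
  \<open>T\<^sup>~\<close> be the row operator of \<open>T\<close>, \<open>Z\<close> that of the scalars \<open>z\<^sup>\<alpha>\<close>, and \<open>C = Z T\<^sup>~\<^sup>*\<close>. The coefficients satisfy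
  \<open>\<Sum>\<^sub>n b\<^sub>n \<le> 1\<close>, so \<open>Z\<close> is a contraction for \<open>\<bar>z\<bar> \<le> 1\<close> and depends norm continuously on \<open>z\<close>. It remains to
  invert \<open>I - C\<close>. As \<open>T\<^sup>~\<close> and \<open>Z\<close> are contractions,
  \<open>\<parallel>T\<^sup>~\<^sup>* h - Z\<^sup>* h\<parallel>\<^sup>2 \<le> 2 Re \<langle>(I - C) h, h\<rangle>\<close>, and the components of degree one on the left give
  \<open>b\<^sub>1 \<parallel>(T\<^sub>i - z\<^sub>i)\<^sup>* h\<parallel>\<^sup>2 \<le> 2 Re \<langle>(I - C) h, h\<rangle>\<close>, where \<open>b\<^sub>1 > 0\<close>. If \<open>z\<close> is not in the Taylor spectrum, exactness of
  the Koszul complex in top degree makes the row \<open>(T\<^sub>i - z\<^sub>i)\<^sub>i\<close> surjective, so its adjoint is bounded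
  below and \<open>I - C\<close> is coercive, hence invertible. The values of the extension map into the defect
  space of \<open>T\<close> because \<open>T\<^sup>~ D = \<Delta> T\<^sup>~\<close> for the two defect operators.\<close>

subsection \<open>Inner products, adjoints and the Riesz representation\<close>

lemma cinner_zero_left [simp]: "cinner 0 y = 0"
  for y :: "'a::complex_inner"
  using cinner_add_left[of 0 0 y] by simp

lemma cinner_zero_right [simp]: "cinner x 0 = 0"
  for x :: "'a::complex_inner"
  using cinner_add_right[of x 0 0] by simp

lemma cinner_minus_left: "cinner (- x) y = - cinner x y"
  for x :: "'a::complex_inner"
  using cinner_add_left[of x "- x" y] by (simp add: eq_neg_iff_add_eq_0 add.commute)

lemma cinner_minus_right: "cinner x (- y) = - cinner x y"
  for x :: "'a::complex_inner"
  using cinner_add_right[of x y "- y"] by (simp add: eq_neg_iff_add_eq_0 add.commute)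

lemma cinner_diff_left: "cinner (x - y) z = cinner x z - cinner y z"
  for x :: "'a::complex_inner"
  by (metis cinner_add_left cinner_minus_left diff_conv_add_uminus)

lemma cinner_diff_right: "cinner x (y - z) = cinner x y - cinner x z"
  for x :: "'a::complex_inner"
  by (metis cinner_add_right cinner_minus_right diff_conv_add_uminus)

lemma cinner_scaleR_left: "cinner (r *\<^sub>R x) y = of_real r * cinner x y"
  for x :: "'a::complex_inner"
  by (simp add: scaleC_of_real[symmetric] cinner_scaleC_left)

lemma cinner_scaleR_right: "cinner x (r *\<^sub>R y) = of_real r * cinner x y"
  for x :: "'a::complex_inner"
  by (simp add: scaleC_of_real[symmetric] cinner_scaleC_right)

lemmas cinner_simps = cinner_add_left cinner_add_right cinner_diff_left cinner_diff_right
  cinner_minus_left cinner_minus_right cinner_scaleR_left cinner_scaleR_right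
  cinner_scaleC_left cinner_scaleC_right

lemma cinner_sum_left: "cinner (\<Sum>i\<in>A. f i) y = (\<Sum>i\<in>A. cinner (f i) y)"
  for y :: "'a::complex_inner"
  by (induction A rule: infinite_finite_induct) (simp_all add: cinner_add_left)

lemma Re_cinner_self: "Re (cinner x x) = (norm x)\<^sup>2"
  for x :: "'a::complex_inner"
  by (simp only: cinner_self Re_complex_of_real)

lemma Re_cinner_commute: "Re (cinner x y) = Re (cinner y x)"
  for x :: "'a::complex_inner"
  by (metis cinner_commute complex_cnj(1) complex.exhaust_sel complex.sel(1))

lemma norm_add_sq: "(norm (x + y))\<^sup>2 = (norm x)\<^sup>2 + 2 * Re (cinner x y) + (norm y)\<^sup>2"
  for x :: "'a::complex_inner"
  by (simp add: Re_cinner_self[symmetric] cinner_add_left cinner_add_right Re_cinner_commute[of y x])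

lemma norm_diff_sq: "(norm (x - y))\<^sup>2 = (norm x)\<^sup>2 - 2 * Re (cinner x y) + (norm y)\<^sup>2"
  for x :: "'a::complex_inner"
  using norm_add_sq[of x "- y"] by (simp add: cinner_minus_right)

lemma scaleC_minus_right: "c *\<^sub>C (- x) = - (c *\<^sub>C x)"
  for x :: "'a::complex_inner"
  by (metis scaleC_of_real scaleC_scaleC mult.commute of_real_1 of_real_minus scaleR_minus1_left)

lemma scaleC_zero_right [simp]: "c *\<^sub>C (0 :: 'a::complex_inner) = 0"
  using norm_scaleC[of c "0::'a"] by simp

lemma scaleC_diff_right: "c *\<^sub>C (x - y) = c *\<^sub>C x - c *\<^sub>C y"
  for x :: "'a::complex_inner"
  by (metis scaleC_add_right scaleC_minus_right diff_conv_add_uminus)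

lemma scaleC_diff_left: "(c - d) *\<^sub>C x = c *\<^sub>C x - d *\<^sub>C x"
  for x :: "'a::complex_inner"
  by (metis add_diff_cancel diff_add_cancel scaleC_add_left)

lemma scaleC_scaleR: "c *\<^sub>C (r *\<^sub>R x) = r *\<^sub>R (c *\<^sub>C x)"
  for x :: "'a::complex_inner"
  by (simp add: scaleC_of_real[symmetric] scaleC_scaleC mult.commute)

text \<open>Expand the nonnegative square of \<open>t u x - y / t\<close>. The unimodular
  \<open>u\<close> rotates the inner product onto the nonnegative reals, and \<open>t\<close>
  balances the two squared norms so that both become \<open>norm x * norm y\<close>.\<close>

lemma Cauchy_Schwarz_cinner: "norm (cinner x y) \<le> norm x * norm y"
  for x :: "'a::complex_inner"
proof (cases "x = 0 \<or> y = 0")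
  case False
  then have pos: "norm x > 0" "norm y > 0" by auto
  define t where "t = sqrt (norm y / norm x)"
  have t: "t > 0" "t\<^sup>2 = norm y / norm x" using pos by (auto simp: t_def)
  obtain u where u: "norm u = 1" "u * cinner x y = of_real (norm (cinner x y))"
  proof (cases "cinner x y = 0")
    case True then show ?thesis using that[of 1] by simp
  next
    case nz: False
    have "cnj (cinner x y) / of_real (norm (cinner x y)) * cinner x y = of_real (norm (cinner x y))"
      using nz by (simp add: field_simps complex_norm_square[symmetric] power2_eq_square
          flip: of_real_mult)
    moreover have "norm (cnj (cinner x y) / of_real (norm (cinner x y))) = 1"
      using nz by (simp add: norm_divide)
    ultimately show ?thesis using that by blast
  qed
  have "0 \<le> (norm (t *\<^sub>R (u *\<^sub>C x) - (1 / t) *\<^sub>R y))\<^sup>2" by simp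
  also have "\<dots> = t\<^sup>2 * (norm x)\<^sup>2 - 2 * norm (cinner x y) + (norm y)\<^sup>2 / t\<^sup>2"
    using t u by (simp add: norm_diff_sq cinner_simps norm_scaleC power_mult_distrib power_divide)
  also have "\<dots> = 2 * (norm x * norm y) - 2 * norm (cinner x y)"
    using t pos by (simp add: power2_eq_square)
  finally show ?thesis by simp
qed auto

lemma Re_cinner_le: "Re (cinner x y) \<le> norm x * norm y"
  for x :: "'a::complex_inner"
  using Cauchy_Schwarz_cinner[of x y] complex_Re_le_cmod order_trans by blast

lemma bounded_linear_cinner_left: "bounded_linear (\<lambda>x. cinner x y)"
  for y :: "'a::complex_inner"
  by (rule bounded_linear_intro[where K = "norm y"])
    (simp_all add: cinner_simps scaleR_conv_of_real Cauchy_Schwarz_cinner)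

lemma bounded_linear_cinner_right: "bounded_linear (\<lambda>y. cinner x y)"
  for x :: "'a::complex_inner"
  by (rule bounded_linear_intro[where K = "norm x"])
    (use Cauchy_Schwarz_cinner[of x] in \<open>simp_all add: cinner_simps scaleR_conv_of_real mult.commute\<close>)

lemma cinner_ext: "x = y" if "\<And>z. cinner z x = cinner z y"
  for x y :: "'a::complex_inner"
proof -
  have "cinner (x - y) (x - y) = 0" using that[of "x - y"] by (simp add: cinner_diff_right)
  then show ?thesis by (simp add: cinner_self)
qed

section \<open>Bounded complex-linear maps, Riesz representation and adjoints\<close>

lemma bounded_clinearI:
  assumes "\<And>x y. A (x + y) = A x + A y" "\<And>c x. A (c *\<^sub>C x) = c *\<^sub>C A x"
    and "\<And>x. norm (A x) \<le> norm x * K"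
  shows "bounded_clinear A"
proof -
  have "bounded_linear A"
    by (rule bounded_linear_intro[OF assms(1) _ assms(3)]) (metis assms(2) scaleC_of_real)
  then show ?thesis using assms(2) by (simp add: bounded_clinear_def)
qed

lemma bounded_clinearD:
  assumes "bounded_clinear A"
  shows "bounded_linear A" "A (x + y) = A x + A y" "A (x - y) = A x - A y" "A (c *\<^sub>C x) = c *\<^sub>C A x"
    "A (r *\<^sub>R x) = r *\<^sub>R A x" "A 0 = 0" "A (- x) = - A x"
  using assms linear_simps[of A]
  by (auto simp: bounded_clinear_def dest: bounded_linear.linear intro: linear_0 linear_neg)

lemma bounded_clinear_compose: "bounded_clinear A \<Longrightarrow> bounded_clinear B \<Longrightarrow> bounded_clinear (\<lambda>x. A (B x))"
  by (simp add: bounded_clinear_def bounded_linear_compose)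

lemma bounded_clinear_diff: "bounded_clinear A \<Longrightarrow> bounded_clinear B \<Longrightarrow> bounded_clinear (\<lambda>x. A x - B x)"
  by (simp add: bounded_clinear_def bounded_linear_sub scaleC_diff_right)

lemma bounded_clinear_add: "bounded_clinear A \<Longrightarrow> bounded_clinear B \<Longrightarrow> bounded_clinear (\<lambda>x. A x + B x)"
  by (simp add: bounded_clinear_def bounded_linear_add scaleC_add_right)

lemma bounded_clinear_id: "bounded_clinear (\<lambda>x. x)"
  by (simp add: bounded_clinear_def bounded_linear_ident)

lemma bounded_clinear_scaleR: "bounded_clinear A \<Longrightarrow> bounded_clinear (\<lambda>x. r *\<^sub>R A x)"
  by (simp add: bounded_clinear_def bounded_linear_const_scaleR scaleC_scaleR)

text \<open>The representing vector is the minimiser of \<open>\<parallel>x\<parallel>\<^sup>2 / 2 - Re (f x)\<close>.\<close>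

lemma riesz_representation:
  fixes f :: "'a::chilbert_space \<Rightarrow> complex"
  assumes f: "bounded_clinear f"
  obtains y where "\<And>x. f x = cinner x y"
proof -
  interpret bounded_linear f using bounded_clinearD(1)[OF f] .
  obtain K where K: "\<And>x. norm (f x) \<le> norm x * K" "0 < K" using pos_bounded by blast
  define \<phi> where "\<phi> x = (norm x)\<^sup>2 / 2 - Re (f x)" for x
  have lower: "- (K\<^sup>2 / 2) \<le> \<phi> x" for x
  proof -
    have "Re (f x) \<le> norm x * K" using K(1)[of x] complex_Re_le_cmod order_trans by blast
    moreover have "0 \<le> (norm x - K)\<^sup>2" by simp
    ultimately show ?thesis by (simp add: \<phi>_def power2_diff)
  qed
  define m where "m = (INF x. \<phi> x)"
  have bdd: "bdd_below (range \<phi>)" using lower by (intro bdd_belowI2[where m = "- (K\<^sup>2 / 2)"])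
  have m_le: "m \<le> \<phi> x" for x unfolding m_def by (rule cINF_lower[OF bdd]) simp
  have "\<exists>x. \<phi> x < m + 1 / real (Suc n)" for n
    using cINF_less_iff[OF UNIV_not_empty bdd, of "m + 1 / real (Suc n)"] by (auto simp: m_def)
  then obtain X where X: "\<And>n. \<phi> (X n) < m + 1 / real (Suc n)" by metis
  \<comment> \<open>The parallelogram law: the linear part of \<open>\<phi>\<close> cancels. Since
    the value at the midpoint is at least \<open>m\<close>, a minimising sequence must be
    Cauchy.\<close>
  have par: "(norm (x - y))\<^sup>2 / 4 = \<phi> x + \<phi> y - 2 * \<phi> ((1/2) *\<^sub>R (x + y))" for x y
    by (simp add: \<phi>_def norm_diff_sq norm_add_sq scaleR add cinner_simps power_divide field_simps)
  have close: "(norm (X i - X j))\<^sup>2 \<le> 4 / real (Suc i) + 4 / real (Suc j)" for i j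
    using par[of "X i" "X j"] X[of i] X[of j] m_le[of "(1/2) *\<^sub>R (X i + X j)"] by simp
  have "Cauchy X"
    unfolding Cauchy_iff
  proof (intro allI impI)
    fix e :: real assume e: "0 < e"
    obtain N where N: "8 / real (Suc N) < e\<^sup>2"
    proof -
      obtain N where "8 / e\<^sup>2 < real N" using reals_Archimedean2 by blast
      then have "8 < real (Suc N) * e\<^sup>2" using e by (simp add: field_simps) (smt (verit) zero_le_power2)
      then show ?thesis using that[of N] by (simp add: field_simps)
    qed
    have "norm (X i - X j) < e" if "i \<ge> N" "j \<ge> N" for i j
    proof -
      have "4 / real (Suc i) \<le> 4 / real (Suc N)" "4 / real (Suc j) \<le> 4 / real (Suc N)"
        using that by (auto intro!: frac_le)
      then have "(norm (X i - X j))\<^sup>2 < e\<^sup>2" using close[of i j] N by linarith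
      then show ?thesis using e power_less_imp_less_base by fastforce
    qed
    then show "\<exists>M. \<forall>m\<ge>M. \<forall>n\<ge>M. norm (X m - X n) < e" by blast
  qed
  then obtain y where y: "X \<longlonglongrightarrow> y" using Cauchy_convergent convergent_def by blast
  have "(\<lambda>n. \<phi> (X n)) \<longlonglongrightarrow> \<phi> y" unfolding \<phi>_def by (intro tendsto_intros y tendsto) simp
  moreover have "(\<lambda>n. m + 1 / real (Suc n)) \<longlonglongrightarrow> m + 0"
    by (intro tendsto_intros LIMSEQ_Suc[OF lim_1_over_n])
  ultimately have "\<phi> y \<le> m + 0"
    by (rule LIMSEQ_le) (use X less_imp_le in blast)
  then have min: "\<phi> y \<le> \<phi> x" for x using m_le[of x] by simp
  have Re: "Re (f v) = Re (cinner v y)" for v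
  proof -
    define d where "d = Re (cinner v y) - Re (f v)"
    \<comment> \<open>The increment of \<open>\<phi>\<close> from its minimiser \<open>y\<close> to
      \<open>y + t v\<close>. Its linear coefficient \<open>d\<close> has to vanish.\<close>
    have q: "0 \<le> t * d + t\<^sup>2 * (norm v)\<^sup>2 / 2" for t
      using min[of "y + t *\<^sub>R v"]
      by (simp add: \<phi>_def norm_add_sq add scaleR cinner_simps d_def Re_cinner_commute[of y v]
          power_mult_distrib algebra_simps add_divide_distrib)
    have "d = 0"
    proof (rule ccontr)
      assume "d \<noteq> 0"
      \<comment> \<open>Adding 1 keeps the divisor positive when \<open>v = 0\<close>. At
        \<open>t = - d / s\<close> the linear term outweighs the quadratic one.\<close>
      define s where "s = (norm v)\<^sup>2 + 1"
      have s: "s > 0" "(norm v)\<^sup>2 < s" by (auto simp: s_def add_nonneg_pos)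
      have "0 \<le> (- d / s) * d + (- d / s)\<^sup>2 * (norm v)\<^sup>2 / 2" by (rule q)
      also have "\<dots> = d\<^sup>2 / s * ((norm v)\<^sup>2 / s / 2 - 1)"
        using s by (simp add: field_simps power2_eq_square)
      also have "\<dots> < 0"
        using s \<open>d \<noteq> 0\<close> by (intro mult_pos_neg) (auto simp: field_simps)
      finally show False by simp
    qed
    then show ?thesis by (simp add: d_def)
  qed
  have "f x = cinner x y" for x
  proof (rule complex_eqI)
    \<comment> \<open>Complex linearity turns the imaginary part at \<open>x\<close> into a real
      part at \<open>\<i> x\<close>.\<close>
    have "Re (f (\<i> *\<^sub>C x)) = Re (cinner (\<i> *\<^sub>C x) y)" by (rule Re)
    then show "Im (f x) = Im (cinner x y)"
      using bounded_clinearD(4)[OF f] by (simp add: cinner_scaleC_left scaleC_complex_def)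
  qed (rule Re)
  then show ?thesis using that by blast
qed

lemma cadjoint_eqI:
  assumes "\<And>x y. cinner (A x) y = cinner x (B y)"
  shows "cadjoint A = B"
  unfolding cadjoint_def
proof (rule the_equality)
  fix B' assume "\<forall>x y. cinner (A x) y = cinner x (B' y)"
  then have "cinner x (B' y) = cinner x (B y)" for x y using assms by metis
  then show "B' = B" by (intro ext) (rule cinner_ext)
qed (use assms in blast)

lemma adjoint_exists:
  fixes A :: "'a::chilbert_space \<Rightarrow> 'b::complex_inner"
  assumes A: "bounded_clinear A"
  obtains B where "\<And>x y. cinner (A x) y = cinner x (B y)"
proof -
  obtain K where K: "\<And>x. norm (A x) \<le> norm x * K" "0 \<le> K"
    using bounded_linear.nonneg_bounded[OF bounded_clinearD(1)[OF A]] by blast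
  have "\<exists>z. \<forall>x. cinner (A x) y = cinner x z" for y
  proof -
    have "bounded_clinear (\<lambda>x. cinner (A x) y)"
    proof (rule bounded_clinearI)
      show "norm (cinner (A x) y) \<le> norm x * (K * norm y)" for x
        using Cauchy_Schwarz_cinner[of "A x" y] mult_right_mono[OF K(1)[of x], of "norm y"]
        by (simp add: mult.assoc)
    qed (simp_all add: bounded_clinearD[OF A] cinner_simps scaleC_complex_def)
    then show ?thesis using riesz_representation by metis
  qed
  then show ?thesis using that by metis
qed

lemma cinner_cadjoint:
  fixes A :: "'a::chilbert_space \<Rightarrow> 'b::complex_inner"
  assumes "bounded_clinear A"
  shows "cinner (A x) y = cinner x (cadjoint A y)"
proof -
  obtain B where B: "\<And>x y. cinner (A x) y = cinner x (B y)"
    using adjoint_exists[OF assms] by blast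
  show ?thesis unfolding cadjoint_eqI[OF B] by (rule B)
qed

text \<open>The square of \<open>norm (B y)\<close> is the inner product of \<open>A (B y)\<close>
  with \<open>y\<close>, which gives the bound; linearity follows because inner products separate
  points. The adjoint relation is a hypothesis, so the lemma serves both \<open>cadjoint\<close> and
  adjoints given by a formula.\<close>

lemma bounded_clinear_adjoint:
  fixes A :: "'a::complex_inner \<Rightarrow> 'b::complex_inner"
  assumes adj: "\<And>x y. cinner (A x) y = cinner x (B y)"
    and K: "\<And>x. norm (A x) \<le> K * norm x" "0 \<le> K"
  shows "bounded_clinear B" "norm (B y) \<le> K * norm y"
proof -
  have bound: "norm (B y) \<le> K * norm y" for y
  proof (cases "B y = 0")
    case True
    then show ?thesis using K(2) by simp
  next
    case False
    have "norm (B y) * norm (B y) = Re (cinner (B y) (B y))"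
      by (simp only: Re_cinner_self power2_eq_square)
    also have "\<dots> = Re (cinner (A (B y)) y)" by (simp add: adj)
    also have "\<dots> \<le> norm (A (B y)) * norm y" by (rule Re_cinner_le)
    also have "\<dots> \<le> K * norm (B y) * norm y" by (intro mult_right_mono K) simp
    finally show ?thesis using False by (simp add: mult.left_commute mult.commute)
  qed
  show "norm (B y) \<le> K * norm y" by (rule bound)
  show "bounded_clinear B"
  proof (rule bounded_clinearI)
    show "norm (B x) \<le> norm x * K" for x using bound[of x] by (simp add: mult.commute)
  qed (rule cinner_ext, simp add: cinner_simps adj[symmetric])+
qed

subsection \<open>Square roots of positive operators\<close>

text \<open>A fixed point \<open>Y\<close> of this iteration satisfies \<open>2 Y = B + Y Y\<close>,
  that is, \<open>I - Y\<close> squares to \<open>I - B\<close>. Hence the limit yields the square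
  root without spectral theory.\<close>

primrec sqrt_iter :: "('a::real_vector \<Rightarrow> 'a) \<Rightarrow> nat \<Rightarrow> 'a \<Rightarrow> 'a" where
  "sqrt_iter B 0 = (\<lambda>x. 0)"
| "sqrt_iter B (Suc n) = (\<lambda>x. (1 / 2) *\<^sub>R (B x + sqrt_iter B n (sqrt_iter B n x)))"

text \<open>The same iteration for the scalar \<open>1\<close>; it dominates the operator iteration, and hence
  its increments, in norm.\<close>

primrec sqrt_majorant :: "nat \<Rightarrow> real" where
  "sqrt_majorant 0 = 0"
| "sqrt_majorant (Suc n) = (1 + (sqrt_majorant n)\<^sup>2) / 2"

lemma sqrt_majorant_bounds: "0 \<le> sqrt_majorant n" "sqrt_majorant n \<le> 1"
proof -
  have "0 \<le> sqrt_majorant n \<and> sqrt_majorant n \<le> 1"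
  proof (induction n)
    case (Suc n)
    then have "(sqrt_majorant n)\<^sup>2 \<le> 1" by (simp add: power_le_one)
    then show ?case by simp
  qed simp
  then show "0 \<le> sqrt_majorant n" "sqrt_majorant n \<le> 1" by auto
qed

lemma sqrt_majorant_step: "sqrt_majorant n \<le> sqrt_majorant (Suc n)"
proof -
  have "0 \<le> (1 - sqrt_majorant n)\<^sup>2" by simp
  then show ?thesis by (simp add: power2_diff)
qed

lemma Cauchy_sqrt_majorant: "Cauchy sqrt_majorant"
proof -
  have "incseq sqrt_majorant" by (rule incseq_SucI) (rule sqrt_majorant_step)
  then have "convergent sqrt_majorant"
    using sqrt_majorant_bounds(2) incseq_convergent by (metis convergentI)
  then show ?thesis by (rule convergent_Cauchy)
qed

definition sqrt_limit :: "('a::real_normed_vector \<Rightarrow> 'a) \<Rightarrow> 'a \<Rightarrow> 'a"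
  where "sqrt_limit B x = lim (\<lambda>n. sqrt_iter B n x)"

text \<open>The setting in which \<open>I - B\<close> is positive. It is applied to the two products
  of the row of \<open>T\<close> with its adjoint, one on the space itself and one on the Hilbert
  sum.\<close>

locale selfadjoint_contraction =
  fixes B :: "'a::chilbert_space \<Rightarrow> 'a"
  assumes clin: "bounded_clinear B"
    and contr: "norm (B x) \<le> norm x"
    and selfadj: "cinner (B x) y = cinner x (B y)"
begin

lemma norm_sqrt_iter_le: "norm (sqrt_iter B n x) \<le> sqrt_majorant n * norm x"
proof (induction n arbitrary: x)
  case (Suc n)
  have "norm (B x + sqrt_iter B n (sqrt_iter B n x)) \<le> norm x + sqrt_majorant n * (sqrt_majorant n * norm x)"
    using Suc[of x] Suc[of "sqrt_iter B n x"] contr[of x] sqrt_majorant_bounds(1)[of n]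
    by (intro norm_triangle_mono) (auto intro: order_trans mult_left_mono)
  then have "norm (sqrt_iter B (Suc n) x) \<le> (1 / 2) * (norm x + sqrt_majorant n * (sqrt_majorant n * norm x))"
    by simp
  also have "\<dots> = sqrt_majorant (Suc n) * norm x"
    by (simp add: power2_eq_square field_simps)
  finally show ?case .
qed simp

lemma norm_sqrt_iter_le1: "norm (sqrt_iter B n x) \<le> norm x"
  using norm_sqrt_iter_le[of n x] sqrt_majorant_bounds[of n]
  by (metis mult_left_le_one_le norm_ge_zero order_trans)

lemma bounded_clinear_sqrt_iter: "bounded_clinear (sqrt_iter B n)"
proof (induction n)
  case 0
  show ?case by (rule bounded_clinearI[where K = 0]) simp_all
next
  case (Suc n)
  show ?case
    unfolding sqrt_iter.simps
    by (rule bounded_clinear_scaleR[OF bounded_clinear_add[OF clin bounded_clinear_compose[OF Suc Suc]]])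
qed

lemma sqrt_iter_selfadj: "cinner (sqrt_iter B n x) y = cinner x (sqrt_iter B n y)"
  by (induction n arbitrary: x y) (simp_all add: cinner_simps selfadj)

text \<open>With \<open>Y\<close> and \<open>Z\<close> consecutive iterates,
  \<open>Z Z - Y Y = (Z - Y) Z + Y (Z - Y)\<close>. Bounding every factor by its scalar counterpart
  gives the difference of the scalar squares, which is twice the next scalar increment.\<close>

lemma norm_sqrt_iter_step:
  "norm (sqrt_iter B (Suc n) x - sqrt_iter B n x) \<le> (sqrt_majorant (Suc n) - sqrt_majorant n) * norm x"
proof (induction n arbitrary: x)
  case 0
  show ?case using contr[of x] by simp
next
  case (Suc n)
  let ?Y = "sqrt_iter B n" and ?Z = "sqrt_iter B (Suc n)"
  let ?y = "sqrt_majorant n" and ?z = "sqrt_majorant (Suc n)"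
  have "sqrt_iter B (Suc (Suc n)) x - ?Z x = (1/2) *\<^sub>R (?Z (?Z x) - ?Y (?Y x))"
    by (subst (1) sqrt_iter.simps(2), subst (3) sqrt_iter.simps(2))
      (simp only: scaleR_diff_right[symmetric] add_diff_cancel_left)
  also have "?Z (?Z x) - ?Y (?Y x) = (?Z (?Z x) - ?Y (?Z x)) + ?Y (?Z x - ?Y x)"
    using bounded_clinearD(3)[OF bounded_clinear_sqrt_iter] by simp
  finally have eq: "sqrt_iter B (Suc (Suc n)) x - ?Z x =
    (1/2) *\<^sub>R ((?Z (?Z x) - ?Y (?Z x)) + ?Y (?Z x - ?Y x))" .
  have linear_arith: "u - v = 2 * (t - s)" if "s = (1 + v) / 2" "t = (1 + u) / 2" for s t u v :: real
    using that by (simp add: field_simps)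
  have norm_half: "norm ((1/2) *\<^sub>R u) \<le> t" if "norm u \<le> 2 * t" for u :: 'a and t
    using that by simp
  have step: "0 \<le> ?z - ?y" using sqrt_majorant_step[of n] by simp
  have "norm (?Z (?Z x) - ?Y (?Z x)) \<le> (?z - ?y) * (?z * norm x)"
    using Suc[of "?Z x"] mult_left_mono[OF norm_sqrt_iter_le[of "Suc n" x] step] by linarith
  moreover have "norm (?Y (?Z x - ?Y x)) \<le> ?y * ((?z - ?y) * norm x)"
    using norm_sqrt_iter_le[of n "?Z x - ?Y x"] mult_left_mono[OF Suc[of x] sqrt_majorant_bounds(1)[of n]]
    by linarith
  ultimately have "norm ((?Z (?Z x) - ?Y (?Z x)) + ?Y (?Z x - ?Y x))
      \<le> (?z - ?y) * (?z * norm x) + ?y * ((?z - ?y) * norm x)"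
    by (rule norm_triangle_mono)
  also have "\<dots> = (?z\<^sup>2 - ?y\<^sup>2) * norm x"
    by (simp only: power2_eq_square algebra_simps)
  also have "?z\<^sup>2 - ?y\<^sup>2 = 2 * (sqrt_majorant (Suc (Suc n)) - ?z)"
    by (rule linear_arith[OF sqrt_majorant.simps(2) sqrt_majorant.simps(2)])
  finally have "norm ((?Z (?Z x) - ?Y (?Z x)) + ?Y (?Z x - ?Y x))
      \<le> 2 * ((sqrt_majorant (Suc (Suc n)) - ?z) * norm x)"
    by (simp only: mult.assoc)
  then have "norm ((1/2) *\<^sub>R ((?Z (?Z x) - ?Y (?Z x)) + ?Y (?Z x - ?Y x)))
      \<le> (sqrt_majorant (Suc (Suc n)) - ?z) * norm x"
    by (rule norm_half)
  then show ?case unfolding eq .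
qed

lemma norm_sqrt_iter_diff:
  assumes "m \<le> n"
  shows "norm (sqrt_iter B n x - sqrt_iter B m x) \<le> (sqrt_majorant n - sqrt_majorant m) * norm x"
  using assms
proof (induction n rule: dec_induct)
  case (step n)
  have "norm (sqrt_iter B (Suc n) x - sqrt_iter B m x) \<le>
    norm (sqrt_iter B (Suc n) x - sqrt_iter B n x) + norm (sqrt_iter B n x - sqrt_iter B m x)"
    by (rule norm_diff_triangle_le[OF order_refl order_refl])
  also have "\<dots> \<le> (sqrt_majorant (Suc n) - sqrt_majorant n) * norm x +
      (sqrt_majorant n - sqrt_majorant m) * norm x"
    by (intro add_mono norm_sqrt_iter_step step)
  finally show ?case by (simp only: algebra_simps)
qed simp

lemma sqrt_iter_tendsto: "(\<lambda>n. sqrt_iter B n x) \<longlonglongrightarrow> sqrt_limit B x"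
proof -
  have "Cauchy (\<lambda>n. sqrt_iter B n x)"
    unfolding Cauchy_iff
  proof (intro allI impI)
    fix e :: real assume e: "0 < e"
    define d where "d = e / (1 + norm x)"
    have "0 < 1 + norm x" by (simp add: add_pos_nonneg)
    then have d: "0 < d" "d * norm x < e"
      using e by (simp_all add: d_def pos_divide_less_eq)
    obtain M where M: "\<And>m n. m \<ge> M \<Longrightarrow> n \<ge> M \<Longrightarrow> \<bar>sqrt_majorant m - sqrt_majorant n\<bar> < d"
      using Cauchy_sqrt_majorant d(1) unfolding Cauchy_iff real_norm_def by meson
    have le: "norm (sqrt_iter B n x - sqrt_iter B m x) < e" if "M \<le> m" "m \<le> n" for m n
    proof -
      have "(sqrt_majorant n - sqrt_majorant m) * norm x \<le> d * norm x"
        using M[of n m] that by (intro mult_right_mono) auto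
      then show ?thesis using norm_sqrt_iter_diff[OF that(2), of x] d(2) by linarith
    qed
    have "norm (sqrt_iter B m x - sqrt_iter B n x) < e" if "m \<ge> M" "n \<ge> M" for m n
      using le[of m n] le[of n m] that by (metis nle_le norm_minus_commute)
    then show "\<exists>M. \<forall>m\<ge>M. \<forall>n\<ge>M. norm (sqrt_iter B m x - sqrt_iter B n x) < e" by blast
  qed
  then show ?thesis
    unfolding sqrt_limit_def using Cauchy_convergent convergent_LIMSEQ_iff by blast
qed

lemma norm_sqrt_limit_le: "norm (sqrt_limit B x) \<le> norm x"
  by (rule LIMSEQ_le_const2[OF tendsto_norm[OF sqrt_iter_tendsto]]) (use norm_sqrt_iter_le1 in blast)

lemma bounded_clinear_sqrt_limit: "bounded_clinear (sqrt_limit B)"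
proof (rule bounded_clinearI)
  fix x y c
  have "(\<lambda>n. sqrt_iter B n (x + y)) \<longlonglongrightarrow> sqrt_limit B x + sqrt_limit B y"
    unfolding bounded_clinearD(2)[OF bounded_clinear_sqrt_iter]
    by (intro tendsto_add sqrt_iter_tendsto)
  then show "sqrt_limit B (x + y) = sqrt_limit B x + sqrt_limit B y"
    using sqrt_iter_tendsto LIMSEQ_unique by blast
  have "bounded_linear (\<lambda>x::'a. c *\<^sub>C x)"
    by (rule bounded_linear_intro[where K = "norm c"])
      (simp_all add: scaleC_add_right scaleC_scaleR norm_scaleC mult.commute)
  then have "(\<lambda>n. sqrt_iter B n (c *\<^sub>C x)) \<longlonglongrightarrow> c *\<^sub>C sqrt_limit B x"
    unfolding bounded_clinearD(4)[OF bounded_clinear_sqrt_iter]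
    by (rule bounded_linear.tendsto) (rule sqrt_iter_tendsto)
  then show "sqrt_limit B (c *\<^sub>C x) = c *\<^sub>C sqrt_limit B x"
    using sqrt_iter_tendsto LIMSEQ_unique by blast
  show "norm (sqrt_limit B x) \<le> norm x * 1" using norm_sqrt_limit_le by simp
qed

lemma sqrt_limit_selfadj: "cinner (sqrt_limit B x) y = cinner x (sqrt_limit B y)"
proof -
  have "(\<lambda>n. cinner (sqrt_iter B n x) y) \<longlonglongrightarrow> cinner (sqrt_limit B x) y"
    by (rule bounded_linear.tendsto[OF bounded_linear_cinner_left sqrt_iter_tendsto])
  moreover have "(\<lambda>n. cinner (sqrt_iter B n x) y) \<longlonglongrightarrow> cinner x (sqrt_limit B y)"
    unfolding sqrt_iter_selfadj
    by (rule bounded_linear.tendsto[OF bounded_linear_cinner_right sqrt_iter_tendsto])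
  ultimately show ?thesis using LIMSEQ_unique by blast
qed

text \<open>The recursion passes to the limit although its quadratic term has two moving factors:
  all iterates are contractions, so the inner iterate may be replaced by its limit with vanishing
  error.\<close>

lemma sqrt_limit_fixpoint: "sqrt_limit B x = (1/2) *\<^sub>R (B x + sqrt_limit B (sqrt_limit B x))"
proof -
  let ?Y = "sqrt_limit B"
  have "(\<lambda>n. sqrt_iter B n (sqrt_iter B n x - ?Y x)) \<longlonglongrightarrow> 0"
  proof (rule Lim_null_comparison)
    show "(\<lambda>n. norm (sqrt_iter B n x - ?Y x)) \<longlonglongrightarrow> 0"
      using sqrt_iter_tendsto[of x] LIM_zero tendsto_norm_zero by blast
  qed (simp add: norm_sqrt_iter_le1)
  then have "(\<lambda>n. sqrt_iter B n (sqrt_iter B n x - ?Y x) + sqrt_iter B n (?Y x)) \<longlonglongrightarrow> 0 + ?Y (?Y x)"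
    by (intro tendsto_add sqrt_iter_tendsto)
  then have "(\<lambda>n. sqrt_iter B n (sqrt_iter B n x)) \<longlonglongrightarrow> ?Y (?Y x)"
    unfolding bounded_clinearD(3)[OF bounded_clinear_sqrt_iter] by simp
  then have "(\<lambda>n. sqrt_iter B (Suc n) x) \<longlonglongrightarrow> (1/2) *\<^sub>R (B x + ?Y (?Y x))"
    unfolding sqrt_iter.simps by (intro tendsto_intros)
  moreover have "(\<lambda>n. sqrt_iter B (Suc n) x) \<longlonglongrightarrow> ?Y x"
    by (rule LIMSEQ_Suc[OF sqrt_iter_tendsto])
  ultimately show ?thesis using LIMSEQ_unique by blast
qed

lemma sqrt_limit_square: "(\<lambda>x. x - sqrt_limit B x) \<circ> (\<lambda>x. x - sqrt_limit B x) = (\<lambda>x. x - B x)"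
proof
  fix x
  have "2 *\<^sub>R sqrt_limit B x = B x + sqrt_limit B (sqrt_limit B x)"
    by (subst sqrt_limit_fixpoint) simp
  then show "((\<lambda>x. x - sqrt_limit B x) \<circ> (\<lambda>x. x - sqrt_limit B x)) x = x - B x"
    by (simp add: bounded_clinearD[OF bounded_clinear_sqrt_limit] scaleR_2 algebra_simps)
qed

lemma sqrt_limit_positive: "positive_op (\<lambda>x. x - sqrt_limit B x)"
  unfolding positive_op_def
proof (intro conjI allI)
  show "bounded_clinear (\<lambda>x. x - sqrt_limit B x)"
    by (intro bounded_clinear_diff bounded_clinear_id bounded_clinear_sqrt_limit)
  fix x
  let ?c = "cinner (x - sqrt_limit B x) x"
  have "cnj ?c = ?c"
    by (metis cinner_commute cinner_diff_left cinner_diff_right sqrt_limit_selfadj)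
  then have "Im ?c = 0" by (simp add: complex_eq_iff)
  moreover have "Re (cinner (sqrt_limit B x) x) \<le> norm x * norm x"
    using Re_cinner_le[of "sqrt_limit B x" x] mult_right_mono[OF norm_sqrt_limit_le[of x], of "norm x"]
    by simp
  then have "0 \<le> Re ?c" by (simp add: cinner_diff_left Re_cinner_self power2_eq_square)
  ultimately show "?c \<in> \<real>\<^sub>\<ge>\<^sub>0" by (simp add: complex_nonneg_Reals_iff)
qed

end

text \<open>The relation passes to every iterate by induction and then to the limit by continuity of
  \<open>L\<close>. With \<open>L\<close> a competing root it gives uniqueness of the square root;
  with \<open>L\<close> the row of \<open>T\<close> it relates the two defect operators.\<close>

lemma sqrt_limit_intertwines:
  assumes "selfadjoint_contraction B" "selfadjoint_contraction B'"
    and L: "bounded_linear L" and eq: "\<And>x. L (B x) = B' (L x)"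
  shows "L (sqrt_limit B x) = sqrt_limit B' (L x)"
proof -
  interpret B: selfadjoint_contraction B by fact
  interpret B': selfadjoint_contraction B' by fact
  interpret bounded_linear L by fact
  have "L (sqrt_iter B n x) = sqrt_iter B' n (L x)" for n x
    by (induction n arbitrary: x) (simp_all add: scaleR add eq zero)
  then have "(\<lambda>n. sqrt_iter B' n (L x)) \<longlonglongrightarrow> L (sqrt_limit B x)"
    using tendsto[OF B.sqrt_iter_tendsto] by simp
  then show ?thesis using B'.sqrt_iter_tendsto LIMSEQ_unique by blast
qed

text \<open>Polarisation: the quadratic form is real, and its values at \<open>x + y\<close> and at
  \<open>x + \<i> y\<close> together determine the sesquilinear form.\<close>

lemma positive_op_selfadj:
  assumes "positive_op P"
  shows "cinner (P x) y = cinner x (P y)"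
proof -
  have lin: "bounded_clinear P" and nn: "\<And>x. cinner (P x) x \<in> \<real>\<^sub>\<ge>\<^sub>0"
    using assms by (auto simp: positive_op_def)
  note P = bounded_clinearD[OF lin]
  have sym: "cinner (P u) u = cinner u (P u)" for u
  proof -
    have "cnj (cinner (P u) u) = cinner (P u) u"
      using nn[of u] by (auto simp: complex_nonneg_Reals_iff complex_eq_iff)
    then show ?thesis by (metis cinner_commute)
  qed
  have 1: "cinner (P x) y + cinner (P y) x = cinner x (P y) + cinner y (P x)"
    using sym[of "x + y"] sym[of x] sym[of y] by (simp add: P cinner_simps algebra_simps)
  have "\<i> * cinner (P y) x - \<i> * cinner (P x) y = \<i> * cinner y (P x) - \<i> * cinner x (P y)"
    using sym[of "x + \<i> *\<^sub>C y"] sym[of x] sym[of y] by (simp add: P cinner_simps algebra_simps)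
  then have "\<i> * (cinner (P y) x - cinner (P x) y) = \<i> * (cinner y (P x) - cinner x (P y))"
    by (simp only: right_diff_distrib)
  then have 2: "cinner (P y) x - cinner (P x) y = cinner y (P x) - cinner x (P y)"
    by simp
  have "2 * cinner (P x) y = 2 * cinner x (P y)" using 1 2 by algebra
  then show ?thesis by simp
qed

text \<open>The form is nonnegative at \<open>y + t P y\<close> for all real \<open>t\<close>. When
  it vanishes at \<open>y\<close>, the term linear in \<open>t\<close> is \<open>2 t n\<close> with
  \<open>n\<close> the squared norm of \<open>P y\<close>, so a small negative \<open>t\<close>
  forces \<open>n = 0\<close>.\<close>

lemma positive_op_eq_0:
  assumes P: "positive_op P" and 0: "cinner (P y) y = 0"
  shows "P y = 0"
proof (rule ccontr)
  assume nz: "P y \<noteq> 0"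
  have lin: "bounded_clinear P" and nn: "\<And>x. 0 \<le> Re (cinner (P x) x)"
    using P by (auto simp: positive_op_def complex_nonneg_Reals_iff)
  note Pl = bounded_clinearD[OF lin]
  define c where "c = Re (cinner (P (P y)) (P y))"
  define n where "n = (norm (P y))\<^sup>2"
  have n: "n > 0" using nz by (simp add: n_def)
  have q: "0 \<le> 2 * t * n + t\<^sup>2 * c" for t
    using nn[of "y + t *\<^sub>R P y"] 0 positive_op_selfadj[OF P, of "P y" y]
    by (simp add: Pl cinner_simps Re_cinner_self c_def n_def power2_eq_square algebra_simps)
  \<comment> \<open>The divisor gives \<open>\<bar>t * c\<bar> \<le> n\<close>, so the quadratic
    term cannot compensate the linear one.\<close>
  define t where "t = - n / (\<bar>c\<bar> + 1)"
  have t: "t < 0" using n by (simp add: t_def add_nonneg_pos divide_pos_pos)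
  have "\<bar>t * c\<bar> \<le> n" using n by (simp add: t_def abs_mult field_simps)
  then have "0 < 2 * n + t * c" using n by linarith
  then have "t * (2 * n + t * c) < 0" by (rule mult_neg_pos[OF t])
  then show False using q[of t] by (simp add: algebra_simps power2_eq_square)
qed

context selfadjoint_contraction
begin

text \<open>\<open>P\<close> commutes with \<open>B = I - P P\<close>, hence with the limit and with
  the root \<open>S\<close> built from it. Then \<open>S + P\<close> annihilates
  \<open>y = S x - P x\<close>; positivity makes both \<open>S y\<close> and \<open>P y\<close>
  zero, and moving \<open>S\<close> and \<open>P\<close> across the inner product of
  \<open>y\<close> with itself gives \<open>y = 0\<close>.\<close>

lemma sqrt_unique:
  assumes P: "positive_op P" and sq: "P \<circ> P = (\<lambda>x. x - B x)"
  shows "P = (\<lambda>x. x - sqrt_limit B x)"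
proof
  fix x
  define S where "S = (\<lambda>x. x - sqrt_limit B x)"
  have S: "positive_op S" "S \<circ> S = (\<lambda>x. x - B x)"
    unfolding S_def by (rule sqrt_limit_positive sqrt_limit_square)+
  have Pl: "bounded_clinear P" and Sl: "bounded_clinear S"
    using P S by (auto simp: positive_op_def)
  note L = bounded_clinearD[OF Pl] bounded_clinearD[OF Sl]
  have PP: "P (P x) = x - B x" and SS: "S (S x) = x - B x" for x
    using sq S(2) by (auto simp: fun_eq_iff)
  have "P (B x) = B (P x)" for x
  proof -
    have "P (x - B x) = P x - B (P x)" using PP[of x] PP[of "P x"] by simp
    then show ?thesis by (simp add: L)
  qed
  then have "P (sqrt_limit B x) = sqrt_limit B (P x)" for x
    by (intro sqrt_limit_intertwines selfadjoint_contraction_axioms L)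
  then have comm: "P (S x) = S (P x)" for x by (simp add: S_def L)
  define y where "y = S x - P x"
  have "S y + P y = 0" by (simp add: y_def L PP SS comm)
  then have "cinner (S y) y + cinner (P y) y = 0" by (simp flip: cinner_add_left)
  moreover have "cinner (S y) y \<in> \<real>\<^sub>\<ge>\<^sub>0" "cinner (P y) y \<in> \<real>\<^sub>\<ge>\<^sub>0"
    using P S by (auto simp: positive_op_def)
  ultimately have "cinner (S y) y = 0" "cinner (P y) y = 0"
    by (auto simp: complex_nonneg_Reals_iff complex_eq_iff)
  then have "S y = 0" "P y = 0" using positive_op_eq_0 P S(1) by blast+
  then have "cinner y y = 0"
    by (simp add: y_def L cinner_simps positive_op_selfadj[OF P] positive_op_selfadj[OF S(1)])
  then have "y = 0" by (simp add: cinner_self)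
  then show "P x = x - sqrt_limit B x" by (simp add: y_def S_def)
qed

lemma sqrt_op_eq: "sqrt_op (\<lambda>x. x - B x) = (\<lambda>x. x - sqrt_limit B x)"
  unfolding sqrt_op_def
  by (rule the_equality) (use sqrt_limit_positive sqrt_limit_square sqrt_unique in blast)+

lemma bounded_clinear_sqrt_op: "bounded_clinear (sqrt_op (\<lambda>x. x - B x))"
  using sqrt_limit_positive by (simp add: sqrt_op_eq positive_op_def)

end

lemma sqrt_op_intertwines:
  assumes "selfadjoint_contraction B" "selfadjoint_contraction B'"
    and L: "bounded_linear L" and eq: "\<And>x. L (B x) = B' (L x)"
  shows "L (sqrt_op (\<lambda>x. x - B x) x) = sqrt_op (\<lambda>x. x - B' x) (L x)"
  using sqrt_limit_intertwines[OF assms]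
  by (simp add: selfadjoint_contraction.sqrt_op_eq assms(1,2) bounded_linear.linear[OF L] linear_diff)

subsection \<open>Row operators on Hilbert sums\<close>

lemma infsum_diff:
  fixes f g :: "'i \<Rightarrow> 'a::real_normed_vector"
  assumes "f summable_on A" "g summable_on A"
  shows "(\<Sum>\<^sub>\<infinity>i\<in>A. f i - g i) = infsum f A - infsum g A"
  using infsum_add[of f A "\<lambda>i. - g i"] assms by (simp add: infsum_uminus summable_on_uminus)

definition hsingle :: "'i \<Rightarrow> 'h \<Rightarrow> ('i, 'h::real_normed_vector) hsum"
  where "hsingle i v = Abs_hsum (\<lambda>j. if j = i then v else 0)"

lemma hsum_nth_hsingle: "hsum_nth (hsingle i v) j = (if j = i then v else 0)"
proof -
  have "(\<lambda>j. (norm (if j = i then v else 0))\<^sup>2) summable_on UNIV"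
    by (subst summable_on_cong_neutral[where T = "{i}" and g = "\<lambda>_. (norm v)\<^sup>2"]) auto
  then show ?thesis unfolding hsingle_def by (subst Abs_hsum_inverse) auto
qed

lemma hsum_nth_sum: "hsum_nth (\<Sum>a\<in>F. f a) j = (\<Sum>a\<in>F. hsum_nth (f a) j)"
  by (induction F rule: infinite_finite_induct) simp_all

text \<open>The error of a finite partial sum is a tail of the summable squared norms. A bounded
  operator on the Hilbert sum is thereby expanded as a series over its values on single
  components.\<close>

lemma has_sum_hsingle:
  fixes x :: "('i, 'h::real_normed_vector) hsum"
  shows "((\<lambda>i. hsingle i (hsum_nth x i)) has_sum x) UNIV"
  unfolding has_sum_def tendsto_iff eventually_finite_subsets_at_top
proof (intro allI impI)
  fix e :: real assume e: "0 < e"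
  let ?f = "\<lambda>i. (norm (hsum_nth x i))\<^sup>2"
  have "\<exists>F. finite F \<and> F \<subseteq> UNIV \<and> dist (sum ?f F) (infsum ?f UNIV) \<le> (e / 2)\<^sup>2"
    by (rule infsum_finite_approximation) (use e hsum_summable in auto)
  then obtain F0 where F0: "finite F0" "infsum ?f UNIV - sum ?f F0 \<le> (e / 2)\<^sup>2"
    by (auto simp: dist_real_def)
  have "dist (\<Sum>i\<in>F. hsingle i (hsum_nth x i)) x < e" if F: "finite F" "F0 \<subseteq> F" for F
  proof -
    have nth: "hsum_nth (x - (\<Sum>i\<in>F. hsingle i (hsum_nth x i))) j = (if j \<in> F then 0 else hsum_nth x j)" for j
      using F(1) by (simp add: hsum_nth_sum hsum_nth_hsingle sum.delta)
    have "hsum_norm (x - (\<Sum>i\<in>F. hsingle i (hsum_nth x i))) \<le> e / 2"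
    proof (rule hsum_norm_leI)
      fix G :: "'i set" assume G: "finite G"
      \<comment> \<open>The error vanishes on \<open>F\<close>, so its mass on \<open>G\<close> is
        that of \<open>G - F\<close>, which lies outside \<open>F0\<close>.\<close>
      have "(\<Sum>j\<in>G. (norm (if j \<in> F then 0 else hsum_nth x j))\<^sup>2) = sum ?f (G - F)"
        by (subst sum.setdiff_irrelevant[symmetric, OF G, where g = "\<lambda>j. (norm (if j \<in> F then 0 else hsum_nth x j))\<^sup>2"])
          (use G in \<open>auto intro!: sum.mono_neutral_cong\<close>)
      also have "\<dots> = sum ?f (F \<union> G) - sum ?f F"
        using G F(1) sum.union_disjoint[of F "G - F" ?f] by (simp add: Un_Diff_cancel)
      also have "sum ?f (F \<union> G) \<le> infsum ?f UNIV"
        by (rule finite_sum_le_infsum) (use G F(1) hsum_summable in auto)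
      also have "sum ?f F0 \<le> sum ?f F" by (rule sum_mono2) (use F in auto)
      ultimately have "(\<Sum>j\<in>G. (norm (if j \<in> F then 0 else hsum_nth x j))\<^sup>2) \<le> (e / 2)\<^sup>2"
        using F0(2) by linarith
      then show "L2_set (\<lambda>i. norm (hsum_nth (x - (\<Sum>i\<in>F. hsingle i (hsum_nth x i))) i)) G \<le> e / 2"
        unfolding nth L2_set_def using e by (intro real_le_lsqrt) (auto intro: sum_nonneg)
    qed
    then show ?thesis
      using e by (simp only: dist_norm norm_minus_commute[of _ x]) (simp add: norm_hsum_def)
  qed
  then show "\<exists>X. finite X \<and> X \<subseteq> UNIV \<and> (\<forall>Y. finite Y \<and> X \<subseteq> Y \<and> Y \<subseteq> UNIV \<longrightarrow>
      dist (\<Sum>i\<in>Y. hsingle i (hsum_nth x i)) x < e)"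
    using F0(1) by blast
qed

text \<open>The bound is placed on the column \<open>h\<close> to \<open>(Rs a h)\<close>, since
  square sums are what the hypotheses control; the row inherits it by duality. Instances are the row
  of \<open>T\<close> and the scalar row of a point, both with \<open>M = 1\<close>, and differences
  of scalar rows, with small \<open>M\<close>.\<close>

locale row_family =
  fixes R Rs :: "'i \<Rightarrow> 'h::chilbert_space \<Rightarrow> 'h" and M :: real
  assumes adj: "cinner (R a x) y = cinner x (Rs a y)"
    and clin: "bounded_clinear (Rs a)"
    and M_nonneg: "0 \<le> M"
    and square_sum: "finite F \<Longrightarrow> (\<Sum>a\<in>F. (norm (Rs a h))\<^sup>2) \<le> (M * norm h)\<^sup>2"
begin

definition col :: "'h \<Rightarrow> ('i, 'h) hsum"
  where "col h = Abs_hsum (\<lambda>a. Rs a h)"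

definition row :: "('i, 'h) hsum \<Rightarrow> 'h"
  where "row x = (\<Sum>\<^sub>\<infinity>a. R a (hsum_nth x a))"

lemma L2_set_Rs_le: "finite F \<Longrightarrow> L2_set (\<lambda>a. norm (Rs a h)) F \<le> M * norm h"
  unfolding L2_set_def using square_sum M_nonneg by (intro real_le_lsqrt) (auto intro: sum_nonneg)

lemma hsum_nth_col [simp]: "hsum_nth (col h) a = Rs a h"
  unfolding col_def by (subst Abs_hsum_inverse[OF hsum_memI[OF L2_set_Rs_le]]) auto

lemma norm_col_le: "norm (col h) \<le> M * norm h"
  unfolding norm_hsum_def by (rule hsum_norm_leI) (simp add: L2_set_Rs_le)

lemma bounded_clinear_col: "bounded_clinear col"
proof (rule bounded_clinearI)
  show "norm (col h) \<le> norm h * M" for h using norm_col_le[of h] by (simp add: mult.commute)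
qed (auto intro!: hsum_eqI simp: bounded_clinearD[OF clin])

lemma cinner_hsingle: "cinner y (hsingle a v) = cinner (hsum_nth y a) v"
proof -
  have "cinner y (hsingle a v) = (\<Sum>\<^sub>\<infinity>j\<in>{a}. cinner (hsum_nth y j) v)"
    unfolding cinner_hsum_def by (rule infsum_cong_neutral) (auto simp: hsum_nth_hsingle)
  then show ?thesis by simp
qed

text \<open>The adjoint of \<open>col\<close> exists and is bounded, and it sends
  \<open>hsingle a v\<close> to \<open>R a v\<close>. Applying it to the expansion of
  \<open>x\<close> into components proves convergence of the series and identifies its sum at
  once.\<close>

lemma row_has_sum: "((\<lambda>a. R a (hsum_nth x a)) has_sum cadjoint col x) UNIV"
proof -
  have adj_col: "cinner (col h) y = cinner h (cadjoint col y)" for h y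
    by (rule cinner_cadjoint[OF bounded_clinear_col])
  have "bounded_linear (cadjoint col)"
    by (rule bounded_clinearD(1)[OF bounded_clinear_adjoint(1)[OF adj_col norm_col_le M_nonneg]])
  then have "(cadjoint col \<circ> (\<lambda>a. hsingle a (hsum_nth x a)) has_sum cadjoint col x) UNIV"
    unfolding o_def by (rule has_sum_bounded_linear) (rule has_sum_hsingle)
  moreover have "cadjoint col (hsingle a v) = R a v" for a v
  proof (rule cinner_ext)
    fix h
    have "cinner h (cadjoint col (hsingle a v)) = cinner (Rs a h) v"
      by (simp add: adj_col[symmetric] cinner_hsingle)
    then show "cinner h (cadjoint col (hsingle a v)) = cinner h (R a v)"
      by (metis adj cinner_commute)
  qed
  ultimately show ?thesis by (simp add: o_def)
qed

lemma row_eq: "row = cadjoint col"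
  using row_has_sum infsumI by (fastforce simp: row_def)

lemma cinner_col: "cinner (col h) x = cinner h (row x)"
  unfolding row_eq by (rule cinner_cadjoint[OF bounded_clinear_col])

lemma cinner_row: "cinner (row x) h = cinner x (col h)"
  by (metis cinner_col cinner_commute)

lemma bounded_clinear_row: "bounded_clinear row"
  and norm_row_le: "norm (row x) \<le> M * norm x"
  by (rule bounded_clinear_adjoint[OF cinner_col norm_col_le M_nonneg])+

lemma cadjoint_row: "cadjoint row = col"
  by (rule cadjoint_eqI) (rule cinner_row)

lemma row_summable: "(\<lambda>a. R a (hsum_nth x a)) summable_on UNIV"
  using row_has_sum summable_on_def by blast

end

lemma row_family_scalar:
  assumes "0 \<le> M" "\<And>F. finite F \<Longrightarrow> (\<Sum>a\<in>F. (cmod (c a))\<^sup>2) \<le> M\<^sup>2"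
  shows "row_family (\<lambda>a h. c a *\<^sub>C h) (\<lambda>a h. cnj (c a) *\<^sub>C h) M"
proof
  fix F :: "'a set" and h :: 'b assume "finite F"
  then show "(\<Sum>a\<in>F. (norm (cnj (c a) *\<^sub>C h))\<^sup>2) \<le> (M * norm h)\<^sup>2"
    using assms(2)[of F]
    by (simp add: norm_scaleC power_mult_distrib mult_right_mono flip: sum_distrib_right)
next
  show "bounded_clinear ((*\<^sub>C) (cnj (c a)) :: 'b \<Rightarrow> 'b)" for a
    by (rule bounded_clinearI[where K = "cmod (c a)"])
      (simp_all add: scaleC_add_right scaleC_scaleC norm_scaleC mult.commute)
qed (simp_all add: assms(1) cinner_simps)

subsection \<open>Surjective rows and coercive perturbations of the identity\<close>

text \<open>A Baire category argument in the spirit of the open mapping theorem. Surjectivity makes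
  the closed sets \<open>E n\<close> cover the space, so one of them contains a ball; comparing its
  centre with a point displaced along \<open>x\<close> bounds \<open>norm x\<close> by
  \<open>s x\<close>.\<close>

lemma surjective_row_adjoint_bounded_below:
  fixes A As :: "'d::finite \<Rightarrow> 'h::chilbert_space \<Rightarrow> 'h"
  assumes adj: "\<And>i x y. cinner (A i x) y = cinner x (As i y)"
    and surj: "\<And>h. \<exists>g. h = (\<Sum>i\<in>UNIV. A i (g i))"
  obtains c where "0 < c" "\<And>x. c * norm x \<le> (\<Sum>i\<in>UNIV. norm (As i x))"
proof -
  define s where "s x = (\<Sum>i\<in>UNIV. norm (As i x))" for x
  have s_nonneg: "0 \<le> s x" for x by (simp add: s_def sum_nonneg)
  define E where "E n = {h. \<forall>x. cmod (cinner h x) \<le> real n * s x}" for n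
  have "closed (E n)" for n
  proof -
    have "E n = (\<Inter>x. {h. cmod (cinner h x) \<le> real n * s x})" by (auto simp: E_def)
    moreover have "closed {h. cmod (cinner h x) \<le> real n * s x}" for x
      by (intro closed_Collect_le continuous_on_norm continuous_on_const
          bounded_linear.continuous_on[OF bounded_linear_cinner_left] continuous_on_id)
    ultimately show ?thesis by auto
  qed
  moreover have "h \<in> (\<Union>n. E n)" for h
  proof -
    obtain g where g: "h = (\<Sum>i\<in>UNIV. A i (g i))" using surj by blast
    obtain n where n: "(\<Sum>i\<in>UNIV. norm (g i)) \<le> real n" using real_arch_simple by blast
    have "cmod (cinner h x) \<le> real n * s x" for x
    proof -
      have "cmod (cinner h x) \<le> (\<Sum>i\<in>UNIV. cmod (cinner (g i) (As i x)))"
        unfolding g by (simp add: cinner_sum_left adj norm_sum)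
      also have "\<dots> \<le> (\<Sum>i\<in>UNIV. norm (g i) * norm (As i x))"
        by (intro sum_mono Cauchy_Schwarz_cinner)
      also have "\<dots> \<le> (\<Sum>i\<in>UNIV. norm (g i) * s x)"
        unfolding s_def by (intro sum_mono mult_left_mono member_le_sum) auto
      also have "\<dots> \<le> real n * s x"
        using mult_right_mono[OF n s_nonneg] by (simp add: sum_distrib_right)
      finally show ?thesis .
    qed
    then show ?thesis by (auto simp: E_def)
  qed
  then have "interior (\<Union>n. E n) \<noteq> {}" by (metis UNIV_eq_I UNIV_not_empty interior_UNIV)
  ultimately have "\<exists>n. interior (E n) \<noteq> {}"
    using Baire_category_alt[of "euclidean :: 'h topology" "range E"]
    by (auto simp: completely_metrizable_space_euclidean)
  then obtain n x0 where "x0 \<in> interior (E n)" by blast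
  then obtain r where r: "0 < r" "ball x0 r \<subseteq> E n" by (auto simp: mem_interior)
  \<comment> \<open>The displacement has norm \<open>r / 2\<close> and the bound of
    \<open>E n\<close> is used twice, whence the factor 4; \<open>n + 1\<close> replaces
    \<open>n\<close> to allow \<open>n = 0\<close>.\<close>
  define c where "c = r / (4 * (real n + 1))"
  have "c * norm x \<le> s x" for x
  proof (cases "x = 0")
    case False
    define u where "u = (r / (2 * norm x)) *\<^sub>R x"
    have "norm u = r / 2" using False r(1) by (simp add: u_def)
    then have "x0 + u \<in> E n" "x0 \<in> E n" using r by (auto simp: dist_norm intro!: subsetD[OF r(2)])
    then have le: "cmod (cinner (x0 + u) x) \<le> real n * s x" "cmod (cinner x0 x) \<le> real n * s x"
      by (auto simp: E_def)
    have "cinner u x = of_real (r / 2 * norm x)"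
      using False by (simp add: u_def cinner_simps cinner_self power2_eq_square)
    then have "r / 2 * norm x = cmod (cinner (x0 + u) x - cinner x0 x)"
      using r(1) by (simp only: cinner_add_left add_diff_cancel_left' norm_of_real)
        (simp add: abs_of_nonneg)
    also have "\<dots> \<le> real n * s x + real n * s x"
      by (rule order_trans[OF norm_triangle_ineq4]) (intro add_mono le)
    also have "\<dots> \<le> 2 * ((real n + 1) * s x)" using s_nonneg[of x] by (simp add: algebra_simps)
    finally show ?thesis by (simp add: c_def field_simps)
  qed (simp add: s_nonneg)
  moreover have "0 < c" using r(1) by (simp add: c_def)
  ultimately show ?thesis using that unfolding s_def by blast
qed

text \<open>Coercivity turns \<open>(I + C) / 2\<close> into a strict contraction, so \<open>u = (u + C u + y) / 2\<close> is solvable.\<close>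

lemma coercive_imp_bij:
  fixes C :: "'h::chilbert_space \<Rightarrow> 'h"
  assumes lin: "bounded_clinear C" and contr: "\<And>x. norm (C x) \<le> norm x"
    and c: "0 < c" "\<And>x. c * (norm x)\<^sup>2 \<le> Re (cinner (x - C x) x)"
  shows "bij (\<lambda>x. x - C x)" and "c * norm x \<le> norm (x - C x)"
proof -
  show below: "c * norm x \<le> norm (x - C x)" for x
  proof (cases "x = 0")
    case False
    have "c * norm x * norm x \<le> norm (x - C x) * norm x"
      using c(2)[of x] Re_cinner_le[of "x - C x" x] by (simp add: power2_eq_square mult.assoc)
    then show ?thesis using False by simp
  qed simp
  note C = bounded_clinearD[OF lin]
  have "inj (\<lambda>x. x - C x)"
  proof (rule injI)
    fix x y assume "x - C x = y - C y"
    then have "(x - y) - C (x - y) = 0" by (simp add: C algebra_simps)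
    then have "c * norm (x - y) \<le> 0" using below[of "x - y"] by simp
    then show "x = y" using c(1) by (simp add: mult_le_0_iff)
  qed
  moreover have "\<exists>u. u - C u = y" for y
  proof -
    \<comment> \<open>Expanding the square of \<open>d + C d\<close> and using coercivity gives the
      squared contraction factor \<open>1 - c / 2\<close>. The maximum guards the root against
      \<open>c > 2\<close>, which can occur only in the zero space.\<close>
    define q where "q = sqrt (max 0 (1 - c / 2))"
    define f where "f u = (1/2) *\<^sub>R (u + C u + y)" for u
    have "dist (f u) (f v) \<le> q * dist u v" for u v
    proof -
      define d where "d = u - v"
      have "f u - f v = (1/2) *\<^sub>R (d + C d)" by (simp add: f_def d_def C scaleR_diff_right[symmetric])
      then have "(norm (f u - f v))\<^sup>2 = (1/4) * (norm (d + C d))\<^sup>2" by (simp add: power_divide)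
      also have "\<dots> \<le> (1 - c / 2) * (norm d)\<^sup>2"
      proof -
        have "Re (cinner d (C d)) \<le> (norm d)\<^sup>2 - c * (norm d)\<^sup>2"
          using c(2)[of d] by (simp add: cinner_diff_left Re_cinner_self Re_cinner_commute[of d])
        moreover have "(norm (C d))\<^sup>2 \<le> (norm d)\<^sup>2" by (simp add: contr power_mono)
        moreover have "1 / 4 * (N + 2 * R + P) \<le> (1 - c / 2) * N" if "R \<le> N - c * N" "P \<le> N"
          for N R P :: real using that by (simp add: field_simps)
        ultimately show ?thesis unfolding norm_add_sq by blast
      qed
      also have "\<dots> \<le> q\<^sup>2 * (norm d)\<^sup>2" by (intro mult_right_mono) (auto simp: q_def)
      finally have "(norm (f u - f v))\<^sup>2 \<le> (q * norm d)\<^sup>2" by (simp add: power_mult_distrib)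
      then show ?thesis
        unfolding dist_norm d_def by (rule power2_le_imp_le) (simp add: q_def)
    qed
    moreover have "0 \<le> q" "q < 1" using c(1) by (auto simp: q_def)
    ultimately obtain u where "f u = u" using banach_fix_type[of q f] by blast
    then have "2 *\<^sub>R u = u + C u + y" by (metis f_def scaleR_half_double scaleR_2 scaleR_add_right)
    then show ?thesis by (metis add_diff_cancel_left' diff_diff_eq scaleR_2 add.commute)
  qed
  ultimately show "bij (\<lambda>x. x - C x)" by (auto simp: bij_def surj_def) metis
qed

subsection \<open>Multi-indices and the coefficients of the kernel\<close>

lemma finite_msize_le: "finite {\<alpha> :: 'd::finite \<Rightarrow> nat. msize \<alpha> \<le> n}"
proof (rule finite_subset)
  have "\<alpha> i \<le> msize \<alpha>" for \<alpha> :: "'d \<Rightarrow> nat" and i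
    unfolding msize_def by (rule member_le_sum) auto
  then show "{\<alpha> :: 'd \<Rightarrow> nat. msize \<alpha> \<le> n} \<subseteq> (UNIV \<rightarrow>\<^sub>E {..n})"
    using order_trans by (fastforce simp: PiE_def)
qed (auto intro: finite_PiE)

lemma finite_msize_eq: "finite {\<alpha> :: 'd::finite \<Rightarrow> nat. msize \<alpha> = n}"
  by (rule finite_subset[OF _ finite_msize_le[of n]]) auto

lemma prod_upd:
  fixes f :: "'d::finite \<Rightarrow> nat \<Rightarrow> 'a::comm_monoid_mult"
  shows "(\<Prod>i\<in>UNIV. f i ((\<alpha>(j := m)) i)) = f j m * (\<Prod>i\<in>UNIV - {j}. f i (\<alpha> i))"
  by (subst prod.remove[of _ j]) auto

text \<open>Raising the exponent of \<open>j\<close> multiplies the monomial by \<open>x j\<close>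
  and the factorial by the new exponent, which the weight \<open>\<beta> j\<close> compensates.
  Indices not reached by raising have \<open>\<beta> j = 0\<close> and contribute nothing.\<close>

lemma multinomial_step:
  fixes x :: "'d::finite \<Rightarrow> real"
  defines "p \<equiv> (\<lambda>\<alpha>. \<Prod>i\<in>UNIV. x i ^ \<alpha> i)"
  shows "x j * (\<Sum>\<alpha> | msize \<alpha> = n. p \<alpha> / mfact \<alpha>) =
    (\<Sum>\<beta> | msize \<beta> = Suc n. real (\<beta> j) * (p \<beta> / mfact \<beta>))"
proof -
  let ?up = "\<lambda>\<alpha>::'d \<Rightarrow> nat. \<alpha>(j := Suc (\<alpha> j))"
  have size: "msize (?up \<alpha>) = Suc (msize \<alpha>)" for \<alpha>
    unfolding msize_def by (subst (1 2) sum.remove[of _ j]) auto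
  have "x j * (\<Sum>\<alpha> | msize \<alpha> = n. p \<alpha> / mfact \<alpha>) =
      (\<Sum>\<alpha> | msize \<alpha> = n. real (?up \<alpha> j) * (p (?up \<alpha>) / mfact (?up \<alpha>)))"
    unfolding sum_distrib_left
  proof (rule sum.cong)
    fix \<alpha> :: "'d \<Rightarrow> nat"
    have "p (?up \<alpha>) = x j * p \<alpha>"
      unfolding p_def prod_upd[where f = "\<lambda>i m. x i ^ m"] by (simp add: prod.remove[of UNIV j])
    moreover have "mfact (?up \<alpha>) = Suc (\<alpha> j) * mfact \<alpha>"
      unfolding mfact_def prod_upd[where f = "\<lambda>i m. fact m"]
      by (simp add: prod.remove[of UNIV j] algebra_simps)
    ultimately show "x j * (p \<alpha> / mfact \<alpha>) = real (?up \<alpha> j) * (p (?up \<alpha>) / mfact (?up \<alpha>))"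
      by (simp del: mult_Suc of_nat_Suc)
  qed simp
  also have "\<dots> = (\<Sum>\<beta> \<in> ?up ` {\<alpha>. msize \<alpha> = n}. real (\<beta> j) * (p \<beta> / mfact \<beta>))"
    by (subst sum.reindex) (auto intro!: inj_onI simp: fun_eq_iff split: if_splits)
  also have "\<dots> = (\<Sum>\<beta> | msize \<beta> = Suc n. real (\<beta> j) * (p \<beta> / mfact \<beta>))"
  proof (rule sum.mono_neutral_left)
    show "\<forall>\<beta>\<in>{\<beta>. msize \<beta> = Suc n} - ?up ` {\<alpha>. msize \<alpha> = n}. real (\<beta> j) * (p \<beta> / mfact \<beta>) = 0"
    proof
      fix \<beta> assume \<beta>: "\<beta> \<in> {\<beta>. msize \<beta> = Suc n} - ?up ` {\<alpha>. msize \<alpha> = n}"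
      have "\<beta> j = 0"
      proof (rule ccontr)
        assume "\<beta> j \<noteq> 0"
        then have eq: "\<beta> = ?up (\<beta>(j := \<beta> j - 1))" by auto
        moreover have "msize (\<beta>(j := \<beta> j - 1)) = n"
          using \<beta> size[of "\<beta>(j := \<beta> j - 1)"] unfolding eq[symmetric] by simp
        ultimately have "\<beta> \<in> ?up ` {\<alpha>. msize \<alpha> = n}" by (intro image_eqI) auto
        then show False using \<beta> by blast
      qed
      then show "real (\<beta> j) * (p \<beta> / mfact \<beta>) = 0" by simp
    qed
  qed (auto simp: finite_msize_eq size)
  finally show ?thesis .
qed

lemma multinomial_theorem:
  fixes x :: "'d::finite \<Rightarrow> real"
  shows "(\<Sum>\<alpha> | msize \<alpha> = n. fact n / mfact \<alpha> * (\<Prod>i\<in>UNIV. x i ^ \<alpha> i)) = (\<Sum>i\<in>UNIV. x i) ^ n"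
proof (induction n)
  case 0
  have "{\<alpha> :: 'd \<Rightarrow> nat. msize \<alpha> = 0} = {\<lambda>_. 0}" by (auto simp: msize_def)
  then show ?case by (simp add: mfact_def)
next
  case (Suc n)
  let ?p = "\<lambda>\<alpha>. \<Prod>i\<in>UNIV. x i ^ \<alpha> i"
  have "(\<Sum>i\<in>UNIV. x i) ^ Suc n =
      (\<Sum>j\<in>UNIV. x j * (\<Sum>\<alpha> | msize \<alpha> = n. fact n / mfact \<alpha> * ?p \<alpha>))"
    by (simp only: Suc power_Suc sum_distrib_right)
  also have "\<dots> = fact n * (\<Sum>j\<in>UNIV. x j * (\<Sum>\<alpha> | msize \<alpha> = n. ?p \<alpha> / mfact \<alpha>))"
    by (simp add: sum_distrib_left mult_ac)
  also have "\<dots> = fact n * (\<Sum>\<beta> | msize \<beta> = Suc n. \<Sum>j\<in>UNIV. real (\<beta> j) * (?p \<beta> / mfact \<beta>))"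
    by (subst sum.swap) (simp only: multinomial_step)
  \<comment> \<open>For fixed \<open>\<beta>\<close> the weights \<open>\<beta> j\<close> add up to
    the degree \<open>Suc n\<close>, the factor missing from the next factorial.\<close>
  also have "\<dots> = fact n * (\<Sum>\<beta> | msize \<beta> = Suc n. real (Suc n) * (?p \<beta> / mfact \<beta>))"
    by (intro arg_cong2[where f = "(*)"] sum.cong)
      (simp_all only: sum_distrib_right[symmetric] of_nat_sum[symmetric] msize_def[symmetric] mem_Collect_eq)
  also have "\<dots> = (\<Sum>\<beta> | msize \<beta> = Suc n. fact (Suc n) / mfact \<beta> * ?p \<beta>)"
    by (simp add: sum_distrib_left mult_ac)
  finally show ?case by simp
qed

lemma msize_midx_pos: "1 \<le> msize (midx \<alpha>)"
  using midx[of \<alpha>] by (auto simp: msize_def fun_eq_iff Suc_le_eq sum_pos2 intro!: Nat.gr0I)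

lemma cmod_mpower_sq: "(cmod (mpower z \<alpha>))\<^sup>2 = (\<Prod>i\<in>UNIV. ((cmod (z $ i))\<^sup>2) ^ \<alpha> i)"
  by (simp add: mpower_def prod_norm[symmetric] norm_power prod_power_distrib power_mult[symmetric] mult.commute)

lemma sum_cmod_sq: "(\<Sum>i\<in>UNIV. (cmod (z $ i))\<^sup>2) = (norm z)\<^sup>2"
  by (simp add: norm_vec_def L2_set_def sum_nonneg)

text \<open>The form in which the kernel enters the operator theory: the bound on the sums makes the
  scalar rows contractive on the closed ball, and \<open>b 1 > 0\<close> gives access to the single
  operators \<open>T i\<close>.\<close>

locale CNP_coefficients =
  fixes b :: "nat \<Rightarrow> real"
  assumes b_nonneg: "1 \<le> n \<Longrightarrow> 0 \<le> b n"
    and b1_pos: "0 < b 1"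
    and b_sum_le: "(\<Sum>n=1..N. b n) \<le> 1"
begin

lemma mcoeff_nonneg: "0 \<le> mcoeff b \<alpha>"
  using b_nonneg[OF msize_midx_pos[of \<alpha>]] by (simp add: mcoeff_def)

text \<open>Enlarge \<open>F\<close> to all multi-indices in a range of degrees and group by degree.
  The multinomial theorem sums degree \<open>n\<close> to \<open>b n\<close> times the
  \<open>n\<close>-th power of the squared norm of \<open>z\<close>, which is at most
  \<open>b n\<close>.\<close>

lemma mcoeff_power_tail:
  fixes z :: "complex ^ 'd::finite"
  assumes F: "finite F" "\<And>\<alpha>. \<alpha> \<in> F \<Longrightarrow> m < msize (midx \<alpha>)" and z: "norm z \<le> 1"
  obtains N where "(\<Sum>\<alpha>\<in>F. mcoeff b \<alpha> * (cmod (mpower z (midx \<alpha>)))\<^sup>2) \<le> (\<Sum>n=Suc m..N. b n)"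
proof -
  define g where "g \<alpha> = b (msize \<alpha>) * fact (msize \<alpha>) / real (mfact \<alpha>) * (cmod (mpower z \<alpha>))\<^sup>2"
    for \<alpha> :: "'d \<Rightarrow> nat"
  \<comment> \<open>The largest degree occurring in \<open>F\<close>; the inserted 0 covers empty
    \<open>F\<close>.\<close>
  define N where "N = Max (insert 0 ((\<lambda>\<alpha>. msize (midx \<alpha>)) ` F))"
  define G where "G = {\<alpha> :: 'd \<Rightarrow> nat. msize \<alpha> \<in> {Suc m..N}}"
  have G: "finite G" unfolding G_def by (rule finite_subset[OF _ finite_msize_le[of N]]) auto
  have "(\<Sum>\<alpha>\<in>F. mcoeff b \<alpha> * (cmod (mpower z (midx \<alpha>)))\<^sup>2) = sum g (midx ` F)"
    by (subst sum.reindex) (auto simp: inj_on_def midx_inject mcoeff_def g_def)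
  also have "\<dots> \<le> sum g G"
  proof (rule sum_mono2[OF G])
    show "midx ` F \<subseteq> G"
      using F by (auto simp: G_def N_def Suc_le_eq intro!: Max_ge)
    show "0 \<le> g \<alpha>" if "\<alpha> \<in> G - midx ` F" for \<alpha>
      using that b_nonneg by (auto simp: g_def G_def)
  qed
  also have "\<dots> = (\<Sum>n=Suc m..N. sum g {\<alpha> \<in> G. msize \<alpha> = n})"
    by (rule sum.group[OF G, symmetric]) (auto simp: G_def)
  also have "\<dots> = (\<Sum>n=Suc m..N. b n * ((norm z)\<^sup>2) ^ n)"
  proof (rule sum.cong)
    fix n assume n: "n \<in> {Suc m..N}"
    have "sum g {\<alpha> \<in> G. msize \<alpha> = n} =
        (\<Sum>\<alpha> | msize \<alpha> = n. b n * (fact n / mfact \<alpha> * (\<Prod>i\<in>UNIV. ((cmod (z $ i))\<^sup>2) ^ \<alpha> i)))"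
      using n by (intro sum.cong) (auto simp: g_def G_def cmod_mpower_sq)
    then show "sum g {\<alpha> \<in> G. msize \<alpha> = n} = b n * ((norm z)\<^sup>2) ^ n"
      by (simp only: sum_distrib_left[symmetric] multinomial_theorem sum_cmod_sq)
  qed simp
  also have "\<dots> \<le> (\<Sum>n=Suc m..N. b n)"
    using z b_nonneg by (intro sum_mono mult_left_le) (auto intro!: power_le_one)
  finally show ?thesis using that by blast
qed

lemma mcoeff_power_sum_le:
  assumes "finite F" "norm z \<le> 1"
  shows "(\<Sum>\<alpha>\<in>F. mcoeff b \<alpha> * (cmod (mpower z (midx \<alpha>)))\<^sup>2) \<le> 1"
proof -
  obtain N where "(\<Sum>\<alpha>\<in>F. mcoeff b \<alpha> * (cmod (mpower z (midx \<alpha>)))\<^sup>2) \<le> (\<Sum>n=Suc 0..N. b n)"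
    using mcoeff_power_tail[of F 0 z] assms msize_midx_pos by (metis One_nat_def Suc_le_lessD)
  then show ?thesis using b_sum_le[of N] by simp
qed

text \<open>The partial sums of \<open>b\<close> are increasing and bounded, so their tails are
  small. The resulting set \<open>G\<close> of low degrees works for all points of the closed ball
  simultaneously.\<close>

lemma mcoeff_power_uniform_tail:
  assumes e: "0 < e"
  obtains G :: "'d::finite nzindex set" where "finite G"
    "\<And>F z. finite F \<Longrightarrow> F \<inter> G = {} \<Longrightarrow> norm z \<le> 1 \<Longrightarrow>
      (\<Sum>\<alpha>\<in>F. mcoeff b \<alpha> * (cmod (mpower z (midx \<alpha>)))\<^sup>2) \<le> e"
proof -
  let ?s = "\<lambda>N. \<Sum>n=1..N. b n"
  have inc: "incseq ?s"
    by (rule incseq_SucI) (use b_nonneg in auto)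
  then have "Cauchy ?s"
    using b_sum_le incseq_convergent convergentI convergent_Cauchy by metis
  then obtain m where m: "\<And>N. N \<ge> m \<Longrightarrow> \<bar>?s N - ?s m\<bar> < e"
    using e unfolding Cauchy_iff real_norm_def by (meson order_refl)
  have tail: "(\<Sum>n=Suc m..N. b n) \<le> e" for N
  proof (cases "m \<le> N")
    case True
    have "?s N = ?s m + (\<Sum>n=Suc m..N. b n)"
      using sum.ub_add_nat[of 1 m b "N - m"] True by simp
    then show ?thesis using m[OF True] by linarith
  qed (use e in simp)
  define G :: "'d nzindex set" where "G = {\<alpha>. msize (midx \<alpha>) \<le> m}"
  have "finite G"
    unfolding G_def
    by (rule finite_imageD[of midx], rule finite_subset[OF _ finite_msize_le[of m]])
      (auto simp: inj_on_def midx_inject)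
  moreover have "(\<Sum>\<alpha>\<in>F. mcoeff b \<alpha> * (cmod (mpower z (midx \<alpha>)))\<^sup>2) \<le> e"
    if F: "finite F" "F \<inter> G = {}" and z: "norm z \<le> 1" for F z
  proof -
    obtain N where "(\<Sum>\<alpha>\<in>F. mcoeff b \<alpha> * (cmod (mpower z (midx \<alpha>)))\<^sup>2) \<le> (\<Sum>n=Suc m..N. b n)"
      by (rule mcoeff_power_tail[OF F(1) _ z, of m]) (use F(2) in \<open>auto simp: G_def\<close>)
    then show ?thesis using tail[of N] by linarith
  qed
  ultimately show ?thesis using that by blast
qed

text \<open>The finitely many indices in \<open>G\<close> are handled by continuity of monomials,
  all others by the uniform tail at \<open>w\<close> and at \<open>z\<close>, using that the squared
  difference is at most twice the sum of the squares.\<close>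

lemma mcoeff_power_diff_small:
  fixes z :: "complex ^ 'd::finite"
  assumes z: "norm z \<le> 1" and e: "0 < e"
  shows "\<forall>\<^sub>F w in at z within cball 0 1. \<forall>F. finite F \<longrightarrow>
    (\<Sum>\<alpha>\<in>F. mcoeff b \<alpha> * (cmod (mpower w (midx \<alpha>) - mpower z (midx \<alpha>)))\<^sup>2) \<le> e"
proof -
  \<comment> \<open>Two tails, each doubled, contribute \<open>e / 2\<close> in total; the other
    half is left for the indices in \<open>G\<close>.\<close>
  obtain G :: "'d nzindex set" where G: "finite G"
    "\<And>F z. finite F \<Longrightarrow> F \<inter> G = {} \<Longrightarrow> norm z \<le> 1 \<Longrightarrow>
      (\<Sum>\<alpha>\<in>F. mcoeff b \<alpha> * (cmod (mpower z (midx \<alpha>)))\<^sup>2) \<le> e / 8"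
    by (rule mcoeff_power_uniform_tail[of "e / 8"]) (use e in auto)
  define t where "t w \<alpha> = mcoeff b \<alpha> * (cmod (mpower w (midx \<alpha>) - mpower z (midx \<alpha>)))\<^sup>2" for w \<alpha>
  have t_nonneg: "0 \<le> t w \<alpha>" for w \<alpha> by (simp add: t_def mcoeff_nonneg)
  have "((\<lambda>w. sum (t w) G) \<longlongrightarrow> sum (t z) G) (at z within cball 0 1)"
    unfolding t_def mpower_def by (intro tendsto_intros)
  moreover have "sum (t z) G = 0" by (simp add: t_def)
  ultimately have "\<forall>\<^sub>F w in at z within cball 0 1. sum (t w) G < e / 2"
    using e by (intro order_tendstoD(2)[where y = 0]) auto
  moreover have "\<forall>\<^sub>F w in at z within cball 0 1. w \<in> cball 0 1"
    by (simp add: eventually_at_filter)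
  ultimately have "\<forall>\<^sub>F w in at z within cball 0 1. \<forall>F. finite F \<longrightarrow> sum (t w) F \<le> e"
  proof eventually_elim
    case (elim w)
    show ?case
    proof (intro allI impI)
      fix F :: "'d nzindex set" assume F: "finite F"
      have w: "norm w \<le> 1" using elim(2) by simp
      have t_le: "t w \<alpha> \<le> 2 * (mcoeff b \<alpha> * (cmod (mpower w (midx \<alpha>)))\<^sup>2) +
          2 * (mcoeff b \<alpha> * (cmod (mpower z (midx \<alpha>)))\<^sup>2)" for \<alpha>
      proof -
        let ?u = "mpower w (midx \<alpha>)" and ?v = "mpower z (midx \<alpha>)"
        have "(cmod (?u - ?v))\<^sup>2 \<le> (cmod ?u + cmod ?v)\<^sup>2"
          by (intro power_mono norm_triangle_ineq4) simp
        also have "\<dots> \<le> 2 * (cmod ?u)\<^sup>2 + 2 * (cmod ?v)\<^sup>2"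
          using sum_squares_bound[of "cmod ?u" "cmod ?v"] by (simp add: power2_sum)
        finally show ?thesis
          unfolding t_def using mult_left_mono[OF _ mcoeff_nonneg[of \<alpha>]]
          by (fastforce simp: algebra_simps)
      qed
      have "sum (t w) F = sum (t w) (F \<inter> G) + sum (t w) (F - G)"
        using sum.Int_Diff[OF F] .
      also have "sum (t w) (F \<inter> G) \<le> sum (t w) G"
        by (rule sum_mono2) (use G(1) t_nonneg in auto)
      also have "sum (t w) (F - G) \<le> (\<Sum>\<alpha>\<in>F - G. 2 * (mcoeff b \<alpha> * (cmod (mpower w (midx \<alpha>)))\<^sup>2) +
          2 * (mcoeff b \<alpha> * (cmod (mpower z (midx \<alpha>)))\<^sup>2))"
        by (intro sum_mono t_le)
      also have "\<dots> \<le> 2 * (e / 8) + 2 * (e / 8)"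
        unfolding sum.distrib sum_distrib_left[symmetric]
        by (intro add_mono mult_left_mono G(2)) (use F w z in auto)
      finally show "sum (t w) F \<le> e" using elim(1) by linarith
    qed
  qed
  then show ?thesis by (simp add: t_def)
qed

end

text \<open>On the diagonal at \<open>sqrt t\<close> times a coordinate vector the inner product
  equals \<open>t\<close>, which reduces both expansions to real power series in one variable.
  Positivity of the \<open>a n\<close> bounds the kernel below by its first two terms.\<close>

lemma CNP_kernel_radial:
  fixes k :: "complex ^ 'd \<Rightarrow> complex ^ 'd \<Rightarrow> complex"
  assumes k: "unitarily_invariant_CNP_kernel k a b" and t: "0 \<le> t" "t < 1"
  obtains \<kappa> where "1 + a 1 * t \<le> \<kappa>" "(\<lambda>n. b (Suc n) * t ^ Suc n) sums (1 - 1 / \<kappa>)"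
proof -
  obtain i :: 'd where True by blast
  define z :: "complex ^ 'd" where "z = axis i (complex_of_real (sqrt t))"
  have nz: "norm z = sqrt t" using t
    by (simp add: z_def norm_vec_def L2_set_def axis_def if_distrib[where f = cmod] if_distrib[where f = "\<lambda>x. x ^ 2"]
        cong: if_cong)
  then have z: "z \<in> ball 0 1" using t by simp
  have zz: "cinner z z = complex_of_real t" unfolding cinner_self nz using t by simp
  have "(\<lambda>n. complex_of_real (a n * t ^ n)) sums k z z"
    using k z unfolding unitarily_invariant_CNP_kernel_def zz[symmetric] of_real_mult of_real_power by blast
  then have \<kappa>: "(\<lambda>n. a n * t ^ n) sums Re (k z z)" "(\<lambda>n. 0) sums Im (k z z)"
    unfolding sums_complex_iff by simp_all
  then have k_real: "k z z = of_real (Re (k z z))"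
    using sums_unique2[OF \<kappa>(2) sums_zero] by (simp add: complex_eq_iff)
  have "(\<lambda>n. complex_of_real (b (Suc n) * t ^ Suc n)) sums (1 - 1 / k z z)"
    using k z unfolding unitarily_invariant_CNP_kernel_def zz[symmetric] of_real_mult of_real_power by blast
  also have "1 - 1 / k z z = of_real (1 - 1 / Re (k z z))"
    by (subst k_real) simp
  finally have "(\<lambda>n. b (Suc n) * t ^ Suc n) sums (1 - 1 / Re (k z z))"
    by (simp only: sums_of_real_iff)
  moreover have "1 + a 1 * t \<le> Re (k z z)"
  proof -
    have "a 0 = 1" "\<And>n. 0 < a n" using k by (auto simp: unitarily_invariant_CNP_kernel_def)
    then have "(\<Sum>n<2. a n * t ^ n) \<le> Re (k z z)"
      unfolding sums_unique[OF \<kappa>(1)]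
      using \<kappa>(1) t by (intro sum_le_suminf) (auto intro: sums_summable simp: less_imp_le)
    then show ?thesis using \<open>a 0 = 1\<close> by (simp add: numeral_2_eq_2)
  qed
  ultimately show ?thesis using that by blast
qed

text \<open>For \<open>t < 1\<close> the partial sums stay below
  \<open>1 - 1 / \<kappa> \<le> 1\<close>, and \<open>t\<close> may tend to 1. If \<open>b 1\<close>
  vanished, the series would be at most \<open>t^2\<close>, whereas \<open>1 - 1 / \<kappa>\<close>
  grows at least linearly in \<open>t\<close> near 0.\<close>

lemma CNP_kernel_coefficients:
  fixes k :: "complex ^ 'd \<Rightarrow> complex ^ 'd \<Rightarrow> complex"
  assumes k: "unitarily_invariant_CNP_kernel k a b"
  shows "CNP_coefficients b"
proof
  show nonneg: "0 \<le> b n" if "1 \<le> n" for n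
    using k that by (simp add: unitarily_invariant_CNP_kernel_def)
  have a1: "0 < a 1" using k by (simp add: unitarily_invariant_CNP_kernel_def)
  have shift: "(\<Sum>n=1..N. b n * t ^ n) = (\<Sum>n<N. b (Suc n) * t ^ Suc n)" for t N
    by (induction N) simp_all
  show sum_le: "(\<Sum>n=1..N. b n) \<le> 1" for N
  proof -
    have "(\<Sum>n=1..N. b n * t ^ n) \<le> 1" if t: "t \<in> {0<..<1}" for t
    proof -
      obtain \<kappa> where \<kappa>: "1 + a 1 * t \<le> \<kappa>" "(\<lambda>n. b (Suc n) * t ^ Suc n) sums (1 - 1 / \<kappa>)"
        using CNP_kernel_radial[OF k, of t] t by auto
      have "(\<Sum>n<N. b (Suc n) * t ^ Suc n) \<le> 1 - 1 / \<kappa>"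
        unfolding sums_unique[OF \<kappa>(2)]
        using sums_summable[OF \<kappa>(2)] t nonneg by (intro sum_le_suminf) auto
      moreover have "0 < a 1 * t" using a1 t by simp
      then have "0 \<le> 1 / \<kappa>" using \<kappa>(1) by simp
      ultimately show ?thesis unfolding shift by linarith
    qed
    then have "\<forall>\<^sub>F t in at_left 1. (\<Sum>n=1..N. b n * t ^ n) \<le> 1"
      by (rule eventually_at_leftI[of 0]) simp_all
    moreover have lim: "((\<lambda>t. \<Sum>n=1..N. b n * t ^ n) \<longlongrightarrow> (\<Sum>n=1..N. b n * 1 ^ n)) (at_left 1)"
      by (intro tendsto_intros)
    ultimately show ?thesis using tendsto_upperbound[OF lim] by simp
  qed
  show "0 < b 1"
  proof (rule ccontr)
    assume "\<not> 0 < b 1"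
    then have b1: "b 1 = 0" using nonneg[of 1] by simp
    \<comment> \<open>Chosen so that \<open>t * (1 + a 1)\<close> is half of \<open>a 1\<close>,
      contradicting the inequality \<open>a 1 \<le> t * (1 + a 1 * t)\<close> reached below.\<close>
    define t where "t = a 1 / (2 * (1 + a 1))"
    have t: "0 < t" "t < 1" using a1 by (auto simp: t_def field_simps)
    obtain \<kappa> where \<kappa>: "1 + a 1 * t \<le> \<kappa>" "(\<lambda>n. b (Suc n) * t ^ Suc n) sums (1 - 1 / \<kappa>)"
      using CNP_kernel_radial[OF k, of t] t by auto
    have "(\<Sum>n<N. b (Suc n) * t ^ Suc n) \<le> t\<^sup>2" for N
    proof -
      have "b n * t ^ n \<le> b n * t\<^sup>2" if "n \<in> {1..N}" for n
      proof (cases "n = 1")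
        case False
        then have "t ^ n \<le> t ^ 2" using that t by (intro power_decreasing) auto
        then show ?thesis using that nonneg by (intro mult_left_mono) auto
      qed (use b1 in simp)
      then have "(\<Sum>n=1..N. b n * t ^ n) \<le> (\<Sum>n=1..N. b n * t\<^sup>2)" by (rule sum_mono)
      also have "\<dots> \<le> 1 * t\<^sup>2"
        unfolding sum_distrib_right[symmetric] by (intro mult_right_mono sum_le) simp
      finally show ?thesis by (simp only: shift mult_1)
    qed
    then have "1 - 1 / \<kappa> \<le> t\<^sup>2"
      using \<kappa>(2) LIMSEQ_le_const2 unfolding sums_def by blast
    moreover have "1 / \<kappa> \<le> 1 / (1 + a 1 * t)"
      using \<kappa>(1) mult_pos_pos[OF a1 t(1)] by (intro divide_left_mono) auto
    ultimately have "1 - 1 / (1 + a 1 * t) \<le> t\<^sup>2" by linarith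
    moreover have p: "0 < 1 + a 1 * t" using mult_pos_pos[OF a1 t(1)] by simp
    moreover have "1 - 1 / (1 + a 1 * t) = a 1 * t / (1 + a 1 * t)"
      using p by (simp add: diff_divide_eq_iff)
    ultimately have "a 1 * t \<le> t\<^sup>2 * (1 + a 1 * t)"
      using p by (simp add: pos_divide_le_eq)
    then have "a 1 \<le> t * (1 + a 1 * t)" using t by (simp add: power2_eq_square)
    also have "\<dots> \<le> t * (1 + a 1 * 1)"
      using a1 t by (intro mult_left_mono add_mono) auto
    also have "\<dots> < a 1" using a1 add_pos_pos[OF a1 mult_pos_pos[OF a1 a1]]
      by (simp add: t_def field_simps)
    finally show False by simp
  qed
qed

subsection \<open>The characteristic function\<close>

lemma bounded_clinear_op_mpower:
  assumes "\<And>i. bounded_clinear (T i)"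
  shows "bounded_clinear (op_mpower T \<alpha>)"
proof -
  have pow: "bounded_clinear (T i ^^ n)" for i n
    by (induction n) (auto simp: id_def o_def bounded_clinear_id intro: bounded_clinear_compose assms)
  have "bounded_clinear (foldr (\<lambda>i A. (T i ^^ \<alpha> i) \<circ> A) xs id)" for xs
    by (induction xs) (auto simp: id_def o_def bounded_clinear_id intro: bounded_clinear_compose pow)
  then show ?thesis by (simp add: op_mpower_def)
qed

definition unit_nzindex :: "'d::finite \<Rightarrow> 'd nzindex"
  where "unit_nzindex i = Abs_nzindex (\<lambda>j. if j = i then 1 else 0)"

lemma midx_unit_nzindex: "midx (unit_nzindex i) = (\<lambda>j. if j = i then 1 else 0)"
  unfolding unit_nzindex_def by (rule Abs_nzindex_inverse) (auto simp: fun_eq_iff)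

lemma mcoeff_unit: "mcoeff b (unit_nzindex i) = b 1"
proof -
  have "mfact (midx (unit_nzindex i)) = 1"
    unfolding mfact_def by (rule prod.neutral) (simp add: midx_unit_nzindex)
  then show ?thesis by (simp add: mcoeff_def midx_unit_nzindex msize_def)
qed

lemma mpower_unit: "mpower z (midx (unit_nzindex i)) = z $ i"
  by (simp add: mpower_def midx_unit_nzindex if_distrib[where f = "\<lambda>n. _ ^ n"] cong: if_cong)

lemma op_mpower_unit: "op_mpower T (midx (unit_nzindex i)) = T i"
proof -
  have "distinct xs \<Longrightarrow> foldr (\<lambda>j A. (T j ^^ (if j = i then 1 else 0)) \<circ> A) xs id =
      (if i \<in> set xs then T i else id)" for xs
    by (induction xs) auto
  then show ?thesis
    by (simp add: op_mpower_def midx_unit_nzindex)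
qed

text \<open>A form concentrated in top degree is closed, since the differential reads only the
  proper subsets \<open>S - {i}\<close>. By exactness it is a boundary, and the top component of a
  boundary is a row sum once the signs are absorbed into \<open>g\<close>.\<close>

lemma koszul_exact_imp_surj:
  fixes A :: "'d::{finite,linorder} \<Rightarrow> 'h::complex_inner \<Rightarrow> 'h"
  assumes lin: "\<And>i. bounded_clinear (A i)" and ex: "koszul_exact A"
  shows "\<exists>g. h = (\<Sum>i\<in>UNIV. A i (g i))"
proof -
  define \<omega> where "\<omega> S = (if S = UNIV then h else 0)" for S :: "'d set"
  have "S - {i} \<noteq> UNIV" for S and i :: 'd by blast
  then have "koszul_diff A \<omega> = (\<lambda>_. 0)"
    by (intro ext) (simp add: koszul_diff_def \<omega>_def bounded_clinearD(6)[OF lin])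
  then obtain \<eta> where "\<omega> = koszul_diff A \<eta>" using ex unfolding koszul_exact_def by blast
  then have "h = koszul_diff A \<eta> UNIV" by (metis \<omega>_def)
  also have "\<dots> = (\<Sum>i\<in>UNIV. A i ((- 1) ^ card {j\<in>UNIV. j < i} *\<^sub>R \<eta> (UNIV - {i})))"
    by (simp add: koszul_diff_def bounded_clinearD(5)[OF lin])
  finally show ?thesis
    by (intro exI[where x = "\<lambda>i. (- 1) ^ card {j\<in>UNIV. j < i} *\<^sub>R \<eta> (UNIV - {i})"])
qed

text \<open>Nonnegativity comes from the quotient at 0, which is \<open>0 / 0 = 0\<close> and
  belongs to the bounded set of quotients.\<close>

lemma onorm_on_bounds:
  assumes "0 \<in> V" "0 \<le> K" and le: "\<And>x. x \<in> V \<Longrightarrow> norm (A x) \<le> K * norm x"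
  shows "0 \<le> onorm_on V A" "onorm_on V A \<le> K"
proof -
  have q: "norm (A x) / norm x \<le> K" if "x \<in> V" for x
    using le[OF that] assms(2) by (cases "x = 0") (simp_all add: divide_le_eq)
  then have "bdd_above ((\<lambda>x. norm (A x) / norm x) ` V)" by (intro bdd_aboveI2)
  from cSUP_upper[OF assms(1) this] show "0 \<le> onorm_on V A" by (simp add: onorm_on_def)
  show "onorm_on V A \<le> K"
    unfolding onorm_on_def using assms(1) q by (intro cSUP_least) auto
qed

section \<open>The row of a contraction and its two defect operators\<close>

locale kernel_contraction = CNP_coefficients b for b :: "nat \<Rightarrow> real" +
  fixes T :: "'d::{finite,linorder} \<Rightarrow> 'h::chilbert_space \<Rightarrow> 'h"
  assumes contraction: "inverse_kernel_contraction b T"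
begin

lemma bounded_clinear_T: "bounded_clinear (T i)"
  using contraction by (auto simp: inverse_kernel_contraction_def commuting_tuple_def)

lemma bounded_clinear_T_mpower: "bounded_clinear (op_mpower T \<alpha>)"
  by (rule bounded_clinear_op_mpower) (rule bounded_clinear_T)

lemma cinner_op_mpower: "cinner (op_mpower T \<alpha> x) y = cinner x (cadjoint (op_mpower T \<alpha>) y)"
  by (rule cinner_cadjoint[OF bounded_clinear_T_mpower])

text \<open>The squared column norms are the inner products of the terms of the kernel sum with
  \<open>h\<close>. Being nonnegative, their finite sums are at most the inner product of the full
  sum with \<open>h\<close>, and that sum is a contraction applied to \<open>h\<close>.\<close>

lemma row_family_T: "row_family (\<lambda>\<alpha> h. sqrt (mcoeff b \<alpha>) *\<^sub>R op_mpower T (midx \<alpha>) h)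
    (\<lambda>\<alpha> h. sqrt (mcoeff b \<alpha>) *\<^sub>R cadjoint (op_mpower T (midx \<alpha>)) h) 1"
proof
  fix \<alpha> :: "'d nzindex"
  obtain K where "\<And>x. norm (op_mpower T (midx \<alpha>) x) \<le> norm x * K" "0 \<le> K"
    using bounded_linear.nonneg_bounded[OF bounded_clinearD(1)[OF bounded_clinear_T_mpower]] by blast
  then show "bounded_clinear (\<lambda>h. sqrt (mcoeff b \<alpha>) *\<^sub>R cadjoint (op_mpower T (midx \<alpha>)) h)"
    by (intro bounded_clinear_scaleR bounded_clinear_adjoint(1)[OF cinner_op_mpower, where K = K])
      (simp_all add: mult.commute)
next
  fix F :: "'d nzindex set" and h :: 'h assume F: "finite F"
  let ?S = "\<Sum>\<^sub>\<infinity>\<alpha>. kernel_sum_term b T \<alpha> h"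
  have sum: "((\<lambda>\<alpha>. kernel_sum_term b T \<alpha> h) has_sum ?S) UNIV" and S: "norm ?S \<le> norm h"
    using contraction by (auto simp: inverse_kernel_contraction_def)
  have "bounded_linear (\<lambda>x. Re (cinner x h))"
    by (rule bounded_linear_compose[OF bounded_linear_Re bounded_linear_cinner_left])
  from has_sum_bounded_linear[OF this sum]
  have "((\<lambda>\<alpha>. Re (cinner (kernel_sum_term b T \<alpha> h) h)) has_sum Re (cinner ?S h)) UNIV"
    by (simp add: o_def)
  moreover have "Re (cinner (kernel_sum_term b T \<alpha> h) h) =
      (norm (sqrt (mcoeff b \<alpha>) *\<^sub>R cadjoint (op_mpower T (midx \<alpha>)) h))\<^sup>2" for \<alpha>
    by (simp add: kernel_sum_term_def cinner_scaleR_left cinner_op_mpower Re_cinner_self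
        power_mult_distrib mcoeff_nonneg)
  ultimately have "((\<lambda>\<alpha>. (norm (sqrt (mcoeff b \<alpha>) *\<^sub>R cadjoint (op_mpower T (midx \<alpha>)) h))\<^sup>2)
      has_sum Re (cinner ?S h)) UNIV"
    by simp
  then have "(\<Sum>\<alpha>\<in>F. (norm (sqrt (mcoeff b \<alpha>) *\<^sub>R cadjoint (op_mpower T (midx \<alpha>)) h))\<^sup>2)
      \<le> Re (cinner ?S h)"
    by (rule has_sum_mono_neutral[OF has_sum_finite[OF F]]) auto
  also have "\<dots> \<le> norm h * norm h"
    by (rule order_trans[OF Re_cinner_le mult_right_mono[OF S]]) simp
  finally show "(\<Sum>\<alpha>\<in>F. (norm (sqrt (mcoeff b \<alpha>) *\<^sub>R cadjoint (op_mpower T (midx \<alpha>)) h))\<^sup>2)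
      \<le> (1 * norm h)\<^sup>2"
    by (simp add: power2_eq_square)
qed (simp_all add: cinner_simps cinner_op_mpower)

sublocale T: row_family "\<lambda>\<alpha> h. sqrt (mcoeff b \<alpha>) *\<^sub>R op_mpower T (midx \<alpha>) h"
    "\<lambda>\<alpha> h. sqrt (mcoeff b \<alpha>) *\<^sub>R cadjoint (op_mpower T (midx \<alpha>)) h" 1
  by (rule row_family_T)

lemma row_op_eq: "row_op b T = T.row"
  by (simp add: fun_eq_iff row_op_def T.row_def)

lemma norm_T_row_le: "norm (T.row x) \<le> norm x" and norm_T_col_le: "norm (T.col h) \<le> norm h"
  using T.norm_row_le[of x] T.norm_col_le[of h] by simp_all

lemma T_row_col: "T.row (T.col h) = (\<Sum>\<^sub>\<infinity>\<alpha>. kernel_sum_term b T \<alpha> h)"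
  unfolding T.row_def
  by (rule infsum_cong)
    (simp add: kernel_sum_term_def mcoeff_nonneg bounded_clinearD(5)[OF bounded_clinear_T_mpower])

lemma selfadjoint_row_col: "selfadjoint_contraction (\<lambda>h. T.row (T.col h))"
  by standard
    (auto intro: bounded_clinear_compose T.bounded_clinear_row T.bounded_clinear_col
      order_trans[OF norm_T_row_le norm_T_col_le] simp: T.cinner_row T.cinner_col)

lemma selfadjoint_col_row: "selfadjoint_contraction (\<lambda>x. T.col (T.row x))"
  by standard
    (auto intro: bounded_clinear_compose T.bounded_clinear_row T.bounded_clinear_col
      order_trans[OF norm_T_col_le norm_T_row_le] simp: T.cinner_row T.cinner_col)

lemma defect_op_eq: "defect_op b T = sqrt_op (\<lambda>h. h - T.row (T.col h))"
  by (simp add: defect_op_def T_row_col)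

lemma row_defect_op_eq: "row_defect_op b T = sqrt_op (\<lambda>x. x - T.col (T.row x))"
  by (simp add: row_defect_op_def row_op_eq T.cadjoint_row)

lemma bounded_clinear_defect_op: "bounded_clinear (defect_op b T)"
  unfolding defect_op_eq by (rule selfadjoint_contraction.bounded_clinear_sqrt_op[OF selfadjoint_row_col])

lemma bounded_clinear_row_defect_op: "bounded_clinear (row_defect_op b T)"
  unfolding row_defect_op_eq by (rule selfadjoint_contraction.bounded_clinear_sqrt_op[OF selfadjoint_col_row])

text \<open>By associativity \<open>T.row\<close> intertwines the products
  \<open>T.col T.row\<close> and \<open>T.row T.col\<close>, hence also the square roots of their
  defects.\<close>

lemma row_row_defect_op: "T.row (row_defect_op b T x) = defect_op b T (T.row x)"
  unfolding defect_op_eq row_defect_op_eq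
  by (rule sqrt_op_intertwines[OF selfadjoint_col_row selfadjoint_row_col
        bounded_clinearD(1)[OF T.bounded_clinear_row]]) simp

section \<open>Scalar rows of points of the closed ball\<close>

definition scalar_coeff :: "complex ^ 'd::{finite,linorder} \<Rightarrow> 'd nzindex \<Rightarrow> complex"
  where "scalar_coeff z \<alpha> = of_real (sqrt (mcoeff b \<alpha>)) * mpower z (midx \<alpha>)"

lemma scalar_coeff_scaleC:
  "scalar_coeff z \<alpha> *\<^sub>C h = sqrt (mcoeff b \<alpha>) *\<^sub>R mpower z (midx \<alpha>) *\<^sub>C h"
  for h :: "'a::complex_inner"
  by (simp add: scalar_coeff_def scaleC_of_real flip: scaleC_scaleC)

lemma row_family_scalar_coeff:
  assumes "norm z \<le> 1"
  shows "row_family (\<lambda>\<alpha> h. scalar_coeff z \<alpha> *\<^sub>C h) (\<lambda>\<alpha> h. cnj (scalar_coeff z \<alpha>) *\<^sub>C (h::'h)) 1"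
  by (rule row_family_scalar)
    (use mcoeff_power_sum_le[OF _ assms] in
      \<open>simp_all add: scalar_coeff_def norm_mult power_mult_distrib mcoeff_nonneg\<close>)

lemma row_scalar_eq:
  assumes "norm z \<le> 1"
  shows "row_scalar b z = row_family.row (\<lambda>\<alpha> h. scalar_coeff z \<alpha> *\<^sub>C (h::'h))"
  unfolding fun_eq_iff row_family.row_def[OF row_family_scalar_coeff[OF assms]]
  by (simp add: row_scalar_def scalar_coeff_scaleC)

lemma bounded_clinear_row_scalar:
  assumes "norm z \<le> 1"
  shows "bounded_clinear (row_scalar b z :: ('d nzindex, 'h) hsum \<Rightarrow> 'h)"
    and "norm (row_scalar b z x :: 'h) \<le> norm x"
  using row_family.bounded_clinear_row[OF row_family_scalar_coeff[OF assms]]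
    row_family.norm_row_le[OF row_family_scalar_coeff[OF assms], of x]
  by (simp_all add: row_scalar_eq[OF assms])

text \<open>The difference of two scalar rows is the scalar row of the coefficient differences, so
  its norm is controlled by their square sum; the threshold for that sum is therefore the square of
  \<open>e\<close>.\<close>

lemma row_scalar_diff_small:
  assumes z: "norm z \<le> 1" and e: "0 < e"
  shows "\<forall>\<^sub>F w in at z within cball 0 1. \<forall>x :: ('d nzindex, 'h) hsum.
    norm (row_scalar b w x - row_scalar b z x) \<le> e * norm x"
proof -
  have "0 < e\<^sup>2" using e by simp
  note mcoeff_power_diff_small[OF z this]
  moreover have "\<forall>\<^sub>F w in at z within cball 0 1. w \<in> cball 0 1"
    by (simp add: eventually_at_filter)
  ultimately show ?thesis
  proof (eventually_elim, intro allI)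
    fix w and x :: "('d nzindex, 'h) hsum"
    assume small: "\<forall>F. finite F \<longrightarrow>
      (\<Sum>\<alpha>\<in>F. mcoeff b \<alpha> * (cmod (mpower w (midx \<alpha>) - mpower z (midx \<alpha>)))\<^sup>2) \<le> e\<^sup>2"
      and w: "w \<in> cball 0 1"
    have nw: "norm w \<le> 1" using w by simp
    have rf: "row_family (\<lambda>\<alpha> h. (scalar_coeff w \<alpha> - scalar_coeff z \<alpha>) *\<^sub>C h)
        (\<lambda>\<alpha> h. cnj (scalar_coeff w \<alpha> - scalar_coeff z \<alpha>) *\<^sub>C (h::'h)) e"
      by (rule row_family_scalar)
        (use small e in \<open>simp_all add: scalar_coeff_def norm_mult power_mult_distrib mcoeff_nonneg
          flip: right_diff_distrib\<close>)
    have "row_scalar b w x - row_scalar b z x =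
        row_family.row (\<lambda>\<alpha> h. (scalar_coeff w \<alpha> - scalar_coeff z \<alpha>) *\<^sub>C h) x"
      using row_family.row_summable[OF row_family_scalar_coeff[OF nw], of x]
        row_family.row_summable[OF row_family_scalar_coeff[OF z], of x]
      unfolding row_family.row_def[OF rf] row_scalar_eq[OF nw] row_scalar_eq[OF z]
        row_family.row_def[OF row_family_scalar_coeff[OF nw]]
        row_family.row_def[OF row_family_scalar_coeff[OF z]]
      by (simp add: scaleC_diff_left infsum_diff)
    then show "norm (row_scalar b w x - row_scalar b z x) \<le> e * norm x"
      using row_family.norm_row_le[OF rf, of x] by simp
  qed
qed

text \<open>Since the row operators of \<open>z\<close> and \<open>T\<close> are contractions, the real part below dominates the
  squared distance of their adjoints at \<open>h\<close>, whose components of degree one measure how far \<open>h\<close> is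
  from a joint eigenvector of the adjoint tuple.\<close>

lemma Re_cinner_resolvent_ge:
  assumes z: "norm z \<le> 1"
  shows "b 1 * (norm (cadjoint (T i) h - cnj (z $ i) *\<^sub>C h))\<^sup>2
    \<le> 2 * Re (cinner (h - row_scalar b z (T.col h)) h)"
proof -
  interpret Z: row_family "\<lambda>\<alpha> h. scalar_coeff z \<alpha> *\<^sub>C h" "\<lambda>\<alpha> h. cnj (scalar_coeff z \<alpha>) *\<^sub>C (h::'h)" 1
    by (rule row_family_scalar_coeff[OF z])
  have "b 1 * (norm (cadjoint (T i) h - cnj (z $ i) *\<^sub>C h))\<^sup>2 =
      (norm (hsum_nth (T.col h - Z.col h) (unit_nzindex i)))\<^sup>2"
  proof -
    have "hsum_nth (T.col h - Z.col h) (unit_nzindex i) =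
        sqrt (b 1) *\<^sub>R (cadjoint (T i) h - cnj (z $ i) *\<^sub>C h)"
      unfolding hsum_nth_minus T.hsum_nth_col Z.hsum_nth_col
      by (simp add: scalar_coeff_def mcoeff_unit mpower_unit op_mpower_unit scaleR_diff_right
          scaleC_of_real flip: scaleC_scaleC)
    then show ?thesis using b1_pos by (simp add: power_mult_distrib)
  qed
  also have "\<dots> \<le> (norm (T.col h - Z.col h))\<^sup>2"
    by (intro power_mono) (simp_all only: norm_hsum_def norm_hsum_nth_le norm_ge_zero)
  also have "\<dots> = (norm (T.col h))\<^sup>2 - 2 * Re (cinner (row_scalar b z (T.col h)) h) + (norm (Z.col h))\<^sup>2"
    by (simp add: norm_diff_sq row_scalar_eq[OF z] Z.cinner_row)
  also have "\<dots> \<le> (norm h)\<^sup>2 - 2 * Re (cinner (row_scalar b z (T.col h)) h) + (norm h)\<^sup>2"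
    using norm_T_col_le[of h] Z.norm_col_le[of h] by (intro add_mono diff_mono power_mono) simp_all
  also have "\<dots> = 2 * Re (cinner (h - row_scalar b z (T.col h)) h)"
    by (simp add: cinner_diff_left Re_cinner_self)
  finally show ?thesis .
qed

text \<open>Outside the Taylor spectrum the row of the \<open>T i - z i\<close> is surjective, so
  its adjoint is bounded below. Each component of that adjoint is in turn controlled by the real
  part on the right.\<close>

lemma resolvent_coercive:
  assumes z: "norm z \<le> 1" "z \<notin> taylor_spectrum T"
  obtains c where "0 < c" "\<And>h. c * (norm h)\<^sup>2 \<le> Re (cinner (h - row_scalar b z (T.col h)) h)"
proof -
  define A where "A i h = T i h - (z $ i) *\<^sub>C h" for i h
  define As where "As i h = cadjoint (T i) h - cnj (z $ i) *\<^sub>C h" for i h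
  have adj: "cinner (A i x) y = cinner x (As i y)" for i x y
    by (simp add: A_def As_def cinner_simps cinner_cadjoint[OF bounded_clinear_T])
  have "bounded_clinear (\<lambda>h::'h. (z $ i) *\<^sub>C h)" for i
    by (rule bounded_clinearI[where K = "cmod (z $ i)"])
      (simp_all add: scaleC_add_right scaleC_scaleC norm_scaleC mult.commute)
  then have "bounded_clinear (A i)" for i
    unfolding A_def by (intro bounded_clinear_diff bounded_clinear_T)
  moreover have "koszul_exact A" using z(2) by (simp add: taylor_spectrum_def A_def[abs_def])
  ultimately have surj: "\<exists>g. h = (\<Sum>i\<in>UNIV. A i (g i))" for h by (rule koszul_exact_imp_surj)
  obtain c where c: "0 < c" "\<And>h. c * norm h \<le> (\<Sum>i\<in>UNIV. norm (As i h))"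
    using surjective_row_adjoint_bounded_below[of A As, OF adj surj] by blast
  let ?n = "real CARD('d)"
  have n: "0 < ?n" by (simp add: card_gt_0_iff)
  \<comment> \<open>The constant results from squaring
    \<open>c * norm h \<le> ?n * sqrt \<rho>\<close>, where \<open>\<rho>\<close> carries the factor
    \<open>2 / b 1\<close>.\<close>
  have "c\<^sup>2 * b 1 / (2 * ?n\<^sup>2) * (norm h)\<^sup>2 \<le> Re (cinner (h - row_scalar b z (T.col h)) h)" for h
  proof -
    define \<rho> where "\<rho> = 2 * Re (cinner (h - row_scalar b z (T.col h)) h) / b 1"
    have le: "(norm (As i h))\<^sup>2 \<le> \<rho>" for i
      using Re_cinner_resolvent_ge[OF z(1), of i h] b1_pos
      by (simp add: \<rho>_def As_def pos_le_divide_eq mult.commute)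
    then have \<rho>: "0 \<le> \<rho>" by (meson order_trans zero_le_power2)
    have "c * norm h \<le> ?n * sqrt \<rho>"
      using c(2)[of h] sum_bounded_above[of UNIV "\<lambda>i. norm (As i h)" "sqrt \<rho>"] le real_le_rsqrt by force
    then have "(c * norm h)\<^sup>2 \<le> (?n * sqrt \<rho>)\<^sup>2" using c(1) by (intro power_mono) auto
    then have "c\<^sup>2 * (norm h)\<^sup>2 \<le> ?n\<^sup>2 * \<rho>" using \<rho> by (simp add: power_mult_distrib)
    then show ?thesis using n b1_pos by (simp add: \<rho>_def field_simps)
  qed
  moreover have "0 < c\<^sup>2 * b 1 / (2 * ?n\<^sup>2)" using c(1) b1_pos n by simp
  ultimately show ?thesis using that by blast
qed

section \<open>The resolvent applied to the scalar row\<close>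

definition resolvent_row :: "complex ^ 'd::{finite,linorder} \<Rightarrow> ('d nzindex, 'h) hsum \<Rightarrow> 'h"
  where "resolvent_row z y = inv (\<lambda>h. h - row_scalar b z (T.col h)) (row_scalar b z y)"

lemma char_fun_eq:
  "char_fun b T z x = - T.row x + defect_op b T (resolvent_row z (row_defect_op b T x))"
  by (simp add: char_fun_def resolvent_row_def row_op_eq T.cadjoint_row)

lemma bounded_clinear_resolvent:
  assumes "norm z \<le> 1"
  shows "bounded_clinear (\<lambda>h. row_scalar b z (T.col h))" "norm (row_scalar b z (T.col h)) \<le> norm h"
  using bounded_clinear_compose[OF bounded_clinear_row_scalar(1)[OF assms] T.bounded_clinear_col]
    order_trans[OF bounded_clinear_row_scalar(2)[OF assms] norm_T_col_le]
  by auto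

text \<open>Coercivity makes the inverse in \<open>resolvent_row\<close> genuine. The equation
  solved by \<open>resolvent_row z y\<close> and the lower bound with \<open>c\<close> are the form
  in which the inverse enters the estimates.\<close>

lemma resolvent_row:
  assumes z: "norm z \<le> 1" "z \<notin> taylor_spectrum T"
  obtains c where "0 < c"
    "\<And>h. c * norm h \<le> norm (h - row_scalar b z (T.col h))"
    "\<And>y. resolvent_row z y - row_scalar b z (T.col (resolvent_row z y)) = row_scalar b z y"
proof -
  obtain c where c: "0 < c" "\<And>h. c * (norm h)\<^sup>2 \<le> Re (cinner (h - row_scalar b z (T.col h)) h)"
    using resolvent_coercive[OF z] by blast
  note co = coercive_imp_bij[OF bounded_clinear_resolvent[OF z(1)] c]
  have "resolvent_row z y - row_scalar b z (T.col (resolvent_row z y)) = row_scalar b z y" for y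
    unfolding resolvent_row_def using surj_f_inv_f[OF bij_is_surj[OF co(1)]] .
  then show ?thesis using that[OF c(1) co(2)] by blast
qed

text \<open>Both sides of each linearity law solve the same equation, whose solution is unique by
  the lower bound. That bound and the contractivity of the scalar row give the norm bound
  \<open>1 / c\<close>.\<close>

lemma bounded_clinear_resolvent_row:
  assumes z: "norm z \<le> 1" "z \<notin> taylor_spectrum T"
  shows "bounded_clinear (resolvent_row z)"
proof -
  obtain c where c: "0 < c" "\<And>h. c * norm h \<le> norm (h - row_scalar b z (T.col h))"
    "\<And>y. resolvent_row z y - row_scalar b z (T.col (resolvent_row z y)) = row_scalar b z y"
    using resolvent_row[OF z] by blast
  note C = bounded_clinearD[OF bounded_clinear_resolvent(1)[OF z(1)]]
  note Z = bounded_clinearD[OF bounded_clinear_row_scalar(1)[OF z(1)]]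
  have uniq: "u = v" if "u - row_scalar b z (T.col u) = v - row_scalar b z (T.col v)" for u v
  proof -
    have "(u - v) - row_scalar b z (T.col (u - v)) = 0" using that by (simp add: C algebra_simps)
    then have "c * norm (u - v) \<le> 0" using c(2)[of "u - v"] by simp
    then show ?thesis using c(1) by (simp add: mult_le_0_iff)
  qed
  show ?thesis
  proof (rule bounded_clinearI)
    show "resolvent_row z (x + y) = resolvent_row z x + resolvent_row z y" for x y
    proof (rule uniq)
      show "resolvent_row z (x + y) - row_scalar b z (T.col (resolvent_row z (x + y))) =
        resolvent_row z x + resolvent_row z y -
        row_scalar b z (T.col (resolvent_row z x + resolvent_row z y))"
        by (simp only: C add_diff_add c(3) Z)
    qed
    show "resolvent_row z (a *\<^sub>C x) = a *\<^sub>C resolvent_row z x" for a x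
    proof (rule uniq)
      show "resolvent_row z (a *\<^sub>C x) - row_scalar b z (T.col (resolvent_row z (a *\<^sub>C x))) =
        a *\<^sub>C resolvent_row z x - row_scalar b z (T.col (a *\<^sub>C resolvent_row z x))"
        by (simp only: c(3) Z C scaleC_diff_right[symmetric])
    qed
    show "norm (resolvent_row z y) \<le> norm y * (1 / c)" for y
    proof -
      have "c * norm (resolvent_row z y) \<le> norm y"
        using c(2)[of "resolvent_row z y"] bounded_clinear_row_scalar(2)[OF z(1), of y]
        by (simp add: c(3))
      then show ?thesis using c(1) by (simp add: field_simps)
    qed
  qed
qed

text \<open>A perturbation argument with the lower bound at \<open>z\<close> only: the difference
  \<open>v\<close> of the two solutions nearly solves the equation at \<open>z\<close>, and the
  error proportional to \<open>norm v\<close> is absorbed into the left-hand side.\<close>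

lemma resolvent_row_diff_small:
  assumes z: "norm z \<le> 1" "z \<notin> taylor_spectrum T" and e: "0 < e"
  shows "\<forall>\<^sub>F w in at z within (cball 0 1 - taylor_spectrum T). \<forall>y.
    norm (resolvent_row w y - resolvent_row z y) \<le> e * norm y"
proof -
  let ?X = "cball 0 1 - taylor_spectrum T"
  obtain c where c: "0 < c" "\<And>h. c * norm h \<le> norm (h - row_scalar b z (T.col h))"
    "\<And>y. resolvent_row z y - row_scalar b z (T.col (resolvent_row z y)) = row_scalar b z y"
    using resolvent_row[OF z] by blast
  obtain K where K: "\<And>y. norm (resolvent_row z y) \<le> norm y * K" "0 \<le> K"
    using bounded_linear.nonneg_bounded[OF bounded_clinearD(1)[OF bounded_clinear_resolvent_row[OF z]]]
    by blast
  \<comment> \<open>The first entry allows \<open>d * norm v\<close> to be absorbed, the second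
    bounds the remaining terms by \<open>c / 2 * e * norm y\<close>.\<close>
  define d where "d = min (c / 2) (e * c / (2 * (1 + K)))"
  have d: "0 < d" "d \<le> c / 2" "d * (1 + K) \<le> c / 2 * e"
  proof -
    show "0 < d" using c(1) e K(2) by (simp add: d_def)
    show "d \<le> c / 2" unfolding d_def by (rule min.cobounded1)
    have "d \<le> e * c / (2 * (1 + K))" by (simp add: d_def)
    then show "d * (1 + K) \<le> c / 2 * e" using K(2) by (simp add: pos_le_divide_eq mult_ac)
  qed
  have "\<forall>\<^sub>F w in at z within cball 0 1. \<forall>x :: ('d nzindex, 'h) hsum.
      norm (row_scalar b w x - row_scalar b z x) \<le> d * norm x"
    by (rule row_scalar_diff_small[OF z(1) d(1)])
  then have "\<forall>\<^sub>F w in at z within ?X. \<forall>x :: ('d nzindex, 'h) hsum.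
      norm (row_scalar b w x - row_scalar b z x) \<le> d * norm x"
    using filter_leD[OF at_le[of ?X "cball 0 1" z]] by blast
  moreover have "\<forall>\<^sub>F w in at z within ?X. w \<in> ?X" by (simp add: eventually_at_filter)
  ultimately show ?thesis
  proof (eventually_elim, intro allI)
    fix w y
    assume small: "\<forall>x :: ('d nzindex, 'h) hsum. norm (row_scalar b w x - row_scalar b z x) \<le> d * norm x"
      and "w \<in> ?X"
    then have w: "norm w \<le> 1" "w \<notin> taylor_spectrum T" by auto
    note C = bounded_clinearD[OF bounded_clinear_resolvent(1)[OF w(1)]]
    let ?u = "resolvent_row z y"
    define v where "v = resolvent_row w y - ?u"
    have w_eq: "resolvent_row w y - row_scalar b w (T.col (resolvent_row w y)) = row_scalar b w y"
      by (rule resolvent_row[OF w]) blast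
    have small_col: "norm (row_scalar b w (T.col h) - row_scalar b z (T.col h)) \<le> d * norm h" for h
      using small norm_T_col_le[of h] d(1) by (meson less_imp_le mult_left_mono order_trans)
    \<comment> \<open>Subtract the equation of \<open>?u\<close> at \<open>z\<close> from that of
      the solution at \<open>w\<close>; what remains is the change of the scalar row, acting on
      \<open>y\<close> and on \<open>T.col ?u\<close>.\<close>
    have "v - row_scalar b w (T.col v) =
        (row_scalar b w y - row_scalar b z y) + (row_scalar b w (T.col ?u) - row_scalar b z (T.col ?u))"
      using w_eq c(3)[of y] by (simp add: v_def C) (simp add: algebra_simps)
    then have "norm (v - row_scalar b w (T.col v)) \<le> d * norm y + d * norm ?u"
      using norm_triangle_mono[OF small[rule_format] small_col] by simp
    also have "\<dots> \<le> d * norm y + d * (norm y * K)"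
      using K(1) d(1) by (intro add_mono mult_left_mono) auto
    also have "\<dots> = d * (1 + K) * norm y" by (simp add: algebra_simps)
    also have "\<dots> \<le> c / 2 * e * norm y" by (intro mult_right_mono d) simp
    finally have 1: "norm (v - row_scalar b w (T.col v)) \<le> c / 2 * e * norm y" .
    have "c * norm v \<le> norm (v - row_scalar b z (T.col v))" by (rule c(2))
    also have "\<dots> = norm ((v - row_scalar b w (T.col v)) + (row_scalar b w (T.col v) - row_scalar b z (T.col v)))"
      by simp
    also have "\<dots> \<le> c / 2 * e * norm y + d * norm v"
      by (rule norm_triangle_mono[OF 1 small_col])
    also have "\<dots> \<le> c / 2 * e * norm y + c / 2 * norm v"
      by (intro add_left_mono mult_right_mono d) simp
    finally have "c / 2 * norm v \<le> c / 2 * (e * norm y)" by (simp add: algebra_simps)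
    then show "norm (resolvent_row w y - resolvent_row z y) \<le> e * norm y"
      using c(1) by (simp add: v_def)
  qed
qed

text \<open>On the range of the row defect operator the term \<open>- T.row\<close> also factors
  through \<open>defect_op\<close>, by the intertwining relation, so the values lie in its range.
  Continuity carries this over to the closures.\<close>

lemma char_fun_bounded_ops:
  assumes z: "norm z \<le> 1" "z \<notin> taylor_spectrum T"
  shows "char_fun b T z \<in> bounded_ops (row_defect_space b T) (defect_space b T)"
proof -
  note L = bounded_clinearD[OF bounded_clinear_defect_op] bounded_clinearD[OF T.bounded_clinear_row]
  have G: "bounded_clinear (\<lambda>x. defect_op b T (resolvent_row z (row_defect_op b T x)))"
    by (rule bounded_clinear_compose[OF bounded_clinear_defect_op bounded_clinear_compose[OF
            bounded_clinear_resolvent_row[OF z] bounded_clinear_row_defect_op]])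
  have \<theta>: "bounded_clinear (char_fun b T z)"
    using bounded_clinear_diff[OF G T.bounded_clinear_row]
    by (simp add: char_fun_eq[abs_def] uminus_add_conv_diff)
  have "char_fun b T z ` closure (range (row_defect_op b T)) \<subseteq> closure (range (defect_op b T))"
  proof (rule image_closure_subset)
    show "continuous_on (closure (range (row_defect_op b T))) (char_fun b T z)"
      by (rule linear_continuous_on[OF bounded_clinearD(1)[OF \<theta>]])
    have "char_fun b T z (row_defect_op b T x) =
        defect_op b T (resolvent_row z (row_defect_op b T (row_defect_op b T x)) - T.row x)" for x
      by (simp add: char_fun_eq row_row_defect_op L)
    then show "char_fun b T z ` range (row_defect_op b T) \<subseteq> closure (range (defect_op b T))"
      using closure_subset by fastforce
  qed simp
  moreover have "\<exists>K. \<forall>x. norm (char_fun b T z x) \<le> K * norm x"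
    using bounded_linear.bounded[OF bounded_clinearD(1)[OF \<theta>]] by (metis mult.commute)
  ultimately show ?thesis
    using bounded_clinearD[OF \<theta>]
    by (auto simp: bounded_ops_def row_defect_space_def defect_space_def)
qed

text \<open>The term \<open>- T.row\<close> cancels in differences, leaving the difference of
  \<open>resolvent_row\<close> at the two points between two fixed bounded operators.\<close>

lemma char_fun_continuous:
  "opnorm_continuous_on (cball 0 1 - taylor_spectrum T) (row_defect_space b T) (defect_space b T)
    (char_fun b T)"
  unfolding opnorm_continuous_on_def
proof (intro conjI ballI)
  fix z assume "z \<in> cball 0 1 - taylor_spectrum T"
  then have z: "norm z \<le> 1" "z \<notin> taylor_spectrum T" by auto
  show "char_fun b T z \<in> bounded_ops (row_defect_space b T) (defect_space b T)"
    by (rule char_fun_bounded_ops[OF z])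
  obtain K where K: "\<And>h. norm (defect_op b T h) \<le> norm h * K" "0 < K"
    using bounded_linear.pos_bounded[OF bounded_clinearD(1)[OF bounded_clinear_defect_op]] by blast
  obtain M where M: "\<And>x. norm (row_defect_op b T x) \<le> norm x * M" "0 < M"
    using bounded_linear.pos_bounded[OF bounded_clinearD(1)[OF bounded_clinear_row_defect_op]] by blast
  have "row_defect_op b T 0 = 0" by (rule bounded_clinearD(6)[OF bounded_clinear_row_defect_op])
  then have zero: "0 \<in> row_defect_space b T"
    unfolding row_defect_space_def by (metis closure_subset rangeI subsetD)
  show "((\<lambda>w. onorm_on (row_defect_space b T) (\<lambda>x. char_fun b T w x - char_fun b T z x)) \<longlongrightarrow> 0)
      (at z within (cball 0 1 - taylor_spectrum T))"
  proof (rule tendstoI)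
    fix e :: real assume e: "0 < e"
    \<comment> \<open>Divides out the bounds \<open>K\<close> and \<open>M\<close> of the two defect
      operators; the factor 2 leaves room for the strict inequality.\<close>
    define d where "d = e / (2 * K * M)"
    have d: "0 < d" using e K(2) M(2) by (simp add: d_def)
    show "\<forall>\<^sub>F w in at z within (cball 0 1 - taylor_spectrum T).
        dist (onorm_on (row_defect_space b T) (\<lambda>x. char_fun b T w x - char_fun b T z x)) 0 < e"
      using resolvent_row_diff_small[OF z d]
    proof eventually_elim
      case (elim w)
      have le: "norm (char_fun b T w x - char_fun b T z x) \<le> e / 2 * norm x" for x
      proof -
        let ?y = "row_defect_op b T x"
        have "char_fun b T w x - char_fun b T z x = defect_op b T (resolvent_row w ?y - resolvent_row z ?y)"
          by (simp add: char_fun_eq bounded_clinearD(3)[OF bounded_clinear_defect_op])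
        also have "norm \<dots> \<le> norm (resolvent_row w ?y - resolvent_row z ?y) * K" by (rule K(1))
        also have "\<dots> \<le> d * norm ?y * K" using elim K(2) by (intro mult_right_mono) auto
        also have "\<dots> \<le> d * (norm x * M) * K"
          using M(1) d K(2) by (intro mult_right_mono mult_left_mono) auto
        also have "\<dots> = e / 2 * norm x" using K(2) M(2) by (simp add: d_def)
        finally show ?thesis .
      qed
      have "0 \<le> onorm_on (row_defect_space b T) (\<lambda>x. char_fun b T w x - char_fun b T z x)"
        "onorm_on (row_defect_space b T) (\<lambda>x. char_fun b T w x - char_fun b T z x) \<le> e / 2"
        by (rule onorm_on_bounds[OF zero _ le]; use e in simp)+
      then show ?case using e by (simp add: dist_real_def)
    qed
  qed
qed

end

theorem proposition3p2:
  fixes k :: "complex ^ 'd::{finite,linorder} \<Rightarrow> complex ^ 'd::{finite,linorder} \<Rightarrow> complex"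
    and a b :: "nat \<Rightarrow> real"
    and T :: "'d \<Rightarrow> 'h::chilbert_space \<Rightarrow> 'h"
  assumes "unitarily_invariant_CNP_kernel k a b"
    and "inverse_kernel_contraction b T"
  shows "\<exists>F. opnorm_continuous_on (cball 0 1 - taylor_spectrum T)
               (row_defect_space b T) (defect_space b T) F \<and>
             (\<forall>z \<in> ball 0 1 - taylor_spectrum T. \<forall>x \<in> row_defect_space b T.
               F z x = char_fun b T z x)"
proof -
  interpret CNP_coefficients b by (rule CNP_kernel_coefficients[OF assms(1)])
  interpret kernel_contraction b T by unfold_locales (rule assms(2))
  \<comment> \<open>The witness is \<open>char_fun b T\<close> itself, whose formula is meaningful
    on the boundary outside the spectrum, so agreement inside the ball is immediate.\<close>
  show ?thesis using char_fun_continuous by blast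
qed

end
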